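(* Let $H$ be a graph and assume that there is $\varepsilon>0$ such that $\mathrm{ex}(n,H) \ge \varepsilon n^{2-1/m_2(H)+\varepsilon}$ for all $n$. Then there exist a constant $C$ depending only on $\varepsilon$ and $H$ and an infinite sequence of positive integers $n$ for which \[ |\mathcal{F}_n(H)| \le 2^{C\cdot \mathrm{ex}(n,H)}. \]
   Context: For a graph $H$, $\mathrm{ex}(n,H)$ is the maximum number of edges in an $n$-vertex graph not containing $H$ as a (not necessarily induced) subgraph, and $\mathcal{F}_n(H)$ is the set of all labeled $H$-free graphs on vertex set $[n]$. The $2$-density of $H$ is $m_2(H)=\max\{\frac{e_F-1}{v_F-1} : F\subseteq H,\ v_F>2\}$, where $v_F,e_F$ denote the numbers of vertices and edges of $F$.
   Formalization: The 2-density is taken with the standard denominator v_F−2 instead of the printed v_F−1 (with which the claim fails for H=K_{1,2}), and "for all n" is read as n≥2, since ex(1,H)=0 for any H with an edge. *)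

theory Defs
  imports Complex_Main
begin

record 'a graph =
  verts :: "'a set"
  edges :: "'a set set"

definition fin_simple_graph :: "'a graph \<Rightarrow> bool" where
  "fin_simple_graph G \<longleftrightarrow>
     finite (verts G) \<and> edges G \<subseteq> {e. e \<subseteq> verts G \<and> card e = 2}"

definition is_subgraph :: "'a graph \<Rightarrow> 'a graph \<Rightarrow> bool" where
  "is_subgraph F H \<longleftrightarrow>
     fin_simple_graph F \<and> verts F \<subseteq> verts H \<and> edges F \<subseteq> edges H"

text \<open>Containment is up to isomorphism and not necessarily induced: an injection of
  the vertices that maps edges to edges, with no condition on non-edges. The whole
  vertex set is embedded, so isolated vertices of \<open>H\<close> count.\<close>

definition contains_copy :: "'b graph \<Rightarrow> 'a graph \<Rightarrow> bool" where
  "contains_copy G H \<longleftrightarrow>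
     (\<exists>f. inj_on f (verts H) \<and> f ` verts H \<subseteq> verts G \<and> (\<forall>e\<in>edges H. f ` e \<in> edges G))"

text \<open>Every finite graph is isomorphic to one whose vertices are natural numbers, so
  these represent all \<open>n\<close>-vertex graphs. The maximum is over a finite set, nonempty
  as soon as \<open>H\<close> has an edge; if \<open>H\<close> is edgeless and has at most \<open>n\<close> vertices,
  then no \<open>n\<close>-vertex graph is \<open>H\<close>-free and the value is unspecified.\<close>

definition ex_number :: "nat \<Rightarrow> 'a graph \<Rightarrow> nat" where
  "ex_number n H =
     Max {card (edges G) |G :: nat graph.
            fin_simple_graph G \<and> card (verts G) = n \<and> \<not> contains_copy G H}"

definition free_graphs :: "nat \<Rightarrow> 'a graph \<Rightarrow> nat graph set" where
  "free_graphs n H =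
     {G. fin_simple_graph G \<and> verts G = {1..n} \<and> \<not> contains_copy G H}"

text \<open>The usual 2-density, with denominator \<open>v\<^sub>F - 2\<close>; the numerator and denominator
  are computed in the reals, so edgeless \<open>F\<close> contribute negative values. It is
  unspecified if \<open>H\<close> has at most two vertices.\<close>

definition two_density :: "'a graph \<Rightarrow> real" where
  "two_density H =
     Max {(real (card (edges F)) - 1) / (real (card (verts F)) - 2) |F.
            is_subgraph F H \<and> card (verts F) > 2}"

end

theory Submission
  imports Defs
begin

text \<open>Let \<open>f(n) = ex(n,H)\<close>, \<open>a = 1/m\<^sub>2(H)\<close> and \<open>\<alpha> = 2 - a + \<epsilon>/2\<close>. As \<open>f(n)/n\<^sup>\<alpha>\<close> is unbounded, it attains
  a new maximum at infinitely many \<open>n\<close>, and there \<open>f(m) \<le> (m/n)\<^sup>\<alpha> f(n)\<close> for all \<open>m \<le> n\<close>.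
  For such \<open>n\<close>, if a graph \<open>G\<close> on \<open>n\<close> vertices has \<open>K f(n)\<close> edges with \<open>K\<close> large, then an average
  set of \<open>m = pn\<close> vertices with \<open>K p\<^sup>2\<^sup>-\<^sup>\<alpha>\<close> a large constant still spans more than \<open>f(m)\<close> edges,
  robustly, so \<open>G\<close> has a family of copies of \<open>H\<close> in which no edge set is overused. Since
  \<open>m\<^sub>2(H)\<close> controls the subgraphs of \<open>H\<close>, the hypergraph container method applies with density
  \<open>\<tau> = p\<^sup>a\<close>: the \<open>H\<close>-free subgraphs of \<open>G\<close> lie in few containers with at most
  \<open>(1 - \<delta>) K f(n)\<close> edges each. The gap between \<open>a\<close> and \<open>2 - \<alpha>\<close> makes the logarithm of the number of
  containers at most \<open>C f(n) K\<^sup>-\<^sup>\<eta>\<close>, and these costs form a geometric series when the step is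
  iterated from the complete graph down to \<open>K = O(1)\<close>.\<close>

section \<open>Containers\<close>

text \<open>A hypergraph is given by a real weight function on sets. Weights are needed because the
  hypergraph of lower uniformity built below is a sum of links, in which the same set can occur
  several times.\<close>

definition wdeg :: "'v set \<Rightarrow> ('v set \<Rightarrow> real) \<Rightarrow> 'v set \<Rightarrow> real" where
  "wdeg V w T = (\<Sum>Z | Z \<subseteq> V \<and> T \<subseteq> Z. w Z)"

definition uniform_weight :: "'v set \<Rightarrow> nat \<Rightarrow> ('v set \<Rightarrow> real) \<Rightarrow> bool" where
  "uniform_weight V s w \<longleftrightarrow> (\<forall>Z. w Z \<ge> 0) \<and> (\<forall>Z. w Z \<noteq> 0 \<longrightarrow> Z \<subseteq> V \<and> card Z = s)"

definition small_subsets :: "'v set \<Rightarrow> real \<Rightarrow> 'v set set" where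
  "small_subsets V k = {S. S \<subseteq> V \<and> real (card S) \<le> k}"

lemma uniform_weightD:
  assumes "uniform_weight V s w"
  shows "w Z \<ge> 0" and "w Z \<noteq> 0 \<Longrightarrow> Z \<subseteq> V" and "w Z \<noteq> 0 \<Longrightarrow> card Z = s"
  using assms by (auto simp: uniform_weight_def)

lemma wdeg_nonneg: "uniform_weight V s w \<Longrightarrow> wdeg V w T \<ge> 0"
  by (auto simp: wdeg_def uniform_weight_def intro: sum_nonneg)

lemma total_le_sum_wdeg:
  assumes V: "finite V" and w: "uniform_weight V s w" and s: "s > 0"
  shows "sum w (Pow V) \<le> (\<Sum>x\<in>V. wdeg V w {x})"
proof -
  have "(\<Sum>x\<in>V. wdeg V w {x}) = (\<Sum>x\<in>V. \<Sum>Z\<in>Pow V. if x \<in> Z then w Z else 0)"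
    unfolding wdeg_def using V by (intro sum.cong refl sum.mono_neutral_cong_left) auto
  also have "\<dots> = (\<Sum>Z\<in>Pow V. \<Sum>x\<in>V. if x \<in> Z then w Z else 0)"
    by (rule sum.swap)
  also have "\<dots> \<ge> sum w (Pow V)"
  proof (rule sum_mono)
    fix Z assume Z: "Z \<in> Pow V"
    show "w Z \<le> (\<Sum>x\<in>V. if x \<in> Z then w Z else 0)"
    proof (cases "w Z = 0")
      case False
      with w s obtain x where x: "x \<in> Z" unfolding uniform_weight_def by fastforce
      have "(if x \<in> Z then w Z else 0) \<le> (\<Sum>x\<in>V. if x \<in> Z then w Z else 0)"
        using x Z V uniform_weightD(1)[OF w] by (intro member_le_sum) auto
      with x show ?thesis by simp
    qed (simp add: sum_nonneg)
  qed
  finally show ?thesis .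
qed

text \<open>Double counting: a set of nonzero weight has \<open>s\<close> elements, so it is seen
  from each of its \<open>2 ^ s\<close> subsets.\<close>

lemma sum_wdeg_subsets:
  assumes V: "finite V" and w: "uniform_weight V s w"
  shows "(\<Sum>T\<in>Pow V. wdeg V w T) = 2 ^ s * sum w (Pow V)"
proof -
  have "(\<Sum>T\<in>Pow V. wdeg V w T) = (\<Sum>T\<in>Pow V. \<Sum>Z\<in>Pow V. if T \<subseteq> Z then w Z else 0)"
    unfolding wdeg_def using V by (intro sum.cong refl sum.mono_neutral_cong_left) auto
  also have "\<dots> = (\<Sum>Z\<in>Pow V. \<Sum>T\<in>Pow V. if T \<subseteq> Z then w Z else 0)"
    by (rule sum.swap)
  also have "\<dots> = (\<Sum>Z\<in>Pow V. 2 ^ s * w Z)"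
  proof (rule sum.cong)
    fix Z assume Z: "Z \<in> Pow V"
    have "(\<Sum>T\<in>Pow V. if T \<subseteq> Z then w Z else 0) = (\<Sum>T\<in>Pow Z. w Z)"
      using Z V by (intro sum.mono_neutral_cong_right) auto
    also have "\<dots> = 2 ^ card Z * w Z"
      using Z V by (simp add: card_Pow finite_subset[of Z V])
    also have "\<dots> = 2 ^ s * w Z"
      using uniform_weightD(3)[OF w, of Z] by (cases "w Z = 0") auto
    finally show "(\<Sum>T\<in>Pow V. if T \<subseteq> Z then w Z else 0) = 2 ^ s * w Z" .
  qed simp
  finally show ?thesis by (simp add: sum_distrib_left)
qed

section \<open>Lowering the uniformity by scanning links\<close>

locale link_scan =
  fixes V :: "'v set" and w :: "'v set \<Rightarrow> real" and t :: nat and D \<tau> \<theta> :: real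
  assumes V: "finite V"
    and w: "uniform_weight V (Suc t) w"
    and t: "t > 0"
    and D: "D > 0" and tau: "\<tau> > 0"
    and theta: "\<theta> > 0"
    and deg: "T \<noteq> {} \<Longrightarrow> T \<subseteq> V \<Longrightarrow> wdeg V w T \<le> D * \<tau> ^ (card T - 1)"
begin

text \<open>The threshold is half of the degree that \<open>admissible\<close> permits: an
  unsaturated \<open>T\<close> can absorb one more link, which adds at most
  \<open>D * \<tau> ^ card T\<close>.\<close>

definition saturated :: "('v set \<Rightarrow> real) \<Rightarrow> 'v set \<Rightarrow> bool" where
  "saturated F T \<longleftrightarrow> T \<noteq> {} \<and> T \<subseteq> V \<and> wdeg V F T > D * \<tau> ^ card T"

definition link :: "('v set \<Rightarrow> real) \<Rightarrow> 'v \<Rightarrow> 'v set \<Rightarrow> real" where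
  "link F v Y = (if v \<notin> Y \<and> (\<forall>T\<subseteq>Y. \<not> saturated F T) then w (insert v Y) else 0)"

definition gain :: "('v set \<Rightarrow> real) \<Rightarrow> 'v \<Rightarrow> real" where
  "gain F v = sum (link F v) (Pow V)"

text \<open>The visiting order is fixed and the set enters only through the membership of visited
  vertices in \<open>X\<close>; this allows the outcome to be recovered from the picked vertices
  alone.\<close>

fun scan :: "'v set \<Rightarrow> 'v list \<Rightarrow> ('v set \<Rightarrow> real) \<Rightarrow> ('v set \<Rightarrow> real)" where
  "scan X [] F = F"
| "scan X (v # vs) F =
     scan X vs (if v \<in> X \<and> gain F v \<ge> \<theta> then (\<lambda>Y. F Y + link F v Y) else F)"

fun picks :: "'v set \<Rightarrow> 'v list \<Rightarrow> ('v set \<Rightarrow> real) \<Rightarrow> 'v set" where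
  "picks X [] F = {}"
| "picks X (v # vs) F =
     (if v \<in> X \<and> gain F v \<ge> \<theta> then insert v (picks X vs (\<lambda>Y. F Y + link F v Y))
      else picks X vs F)"

lemma picks_subset: "picks X vs F \<subseteq> X \<inter> set vs"
  by (induction vs arbitrary: F) (auto split: if_splits)

lemma scan_cong: "X \<inter> set vs = X' \<inter> set vs \<Longrightarrow> scan X vs F = scan X' vs F"
proof (induction vs arbitrary: F)
  case (Cons v vs)
  have "X \<inter> set vs = X' \<inter> set vs" "v \<in> X \<longleftrightarrow> v \<in> X'" using Cons.prems by auto
  then show ?case using Cons.IH by simp
qed simp

text \<open>Hence the picked elements serve as the fingerprint of \<open>X\<close>.\<close>

lemma scan_picks: "distinct vs \<Longrightarrow> scan (picks X vs F) vs F = scan X vs F"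
proof (induction vs arbitrary: F)
  case (Cons v vs)
  define F' where "F' = (if v \<in> X \<and> gain F v \<ge> \<theta> then (\<lambda>Y. F Y + link F v Y) else F)"
  let ?P = "picks X (v # vs) F"
  have v: "v \<notin> set vs" using Cons.prems by simp
  have mem: "v \<in> ?P \<longleftrightarrow> v \<in> X \<and> gain F v \<ge> \<theta>" using picks_subset[of X vs] v by auto
  have "?P \<inter> set vs = picks X vs F' \<inter> set vs" using v by (auto simp: F'_def)
  then have "scan ?P vs F' = scan X vs F'"
    using scan_cong Cons by (metis distinct.simps(2))
  moreover have "(if v \<in> ?P \<and> gain F v \<ge> \<theta> then (\<lambda>Y. F Y + link F v Y) else F) = F'"
    unfolding mem F'_def by auto
  ultimately show ?case by (simp only: scan.simps F'_def[symmetric])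
qed simp

lemma link_nonneg: "link F v Y \<ge> 0"
  using uniform_weightD(1)[OF w] by (simp add: link_def)

lemma scan_mono: "F Y \<le> scan X vs F Y"
proof (induction vs arbitrary: F)
  case (Cons v vs)
  have "F Y \<le> (if v \<in> X \<and> gain F v \<ge> \<theta> then (\<lambda>Y. F Y + link F v Y) else F) Y"
    using link_nonneg by simp
  also have "\<dots> \<le> scan X (v # vs) F Y" unfolding scan.simps by (rule Cons.IH)
  finally show ?case .
qed simp

text \<open>More weight in \<open>F\<close> saturates more sets, and each further saturated set can
  only remove edges from the link.\<close>

lemma gain_antimono:
  assumes "\<And>Y. F Y \<le> F' Y" shows "gain F' v \<le> gain F v"
proof -
  have "wdeg V F T \<le> wdeg V F' T" for T unfolding wdeg_def by (intro sum_mono assms)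
  then have "saturated F T \<Longrightarrow> saturated F' T" for T
    unfolding saturated_def by (meson less_le_trans)
  then show ?thesis unfolding gain_def
    by (intro sum_mono) (auto simp: link_def uniform_weightD(1)[OF w])
qed

text \<open>An unpicked vertex of \<open>X\<close> had gain below \<open>\<theta>\<close> when it
  was visited, and by \<open>gain_antimono\<close> the gain cannot grow afterwards.\<close>

lemma gain_scan_less:
  "v \<in> X \<inter> set vs \<Longrightarrow> v \<notin> picks X vs F \<Longrightarrow> gain (scan X vs F) v < \<theta>"
proof (induction vs arbitrary: F)
  case (Cons u vs)
  define F' where "F' = (if u \<in> X \<and> gain F u \<ge> \<theta> then (\<lambda>Y. F Y + link F u Y) else F)"
  show ?case
  proof (cases "v = u")
    case True
    then have "gain F v < \<theta>" using Cons.prems by (auto split: if_splits)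
    moreover have "gain (scan X (u # vs) F) v \<le> gain F v"
      by (rule gain_antimono) (rule scan_mono)
    ultimately show ?thesis by linarith
  next
    case False
    then have "v \<in> X \<inter> set vs" "v \<notin> picks X vs F'"
      using Cons.prems by (auto simp: F'_def split: if_splits)
    then have "gain (scan X vs F') v < \<theta>" by (rule Cons.IH)
    then show ?thesis by (simp only: scan.simps F'_def)
  qed
qed simp

text \<open>Every pick adds its gain, at least \<open>\<theta>\<close>, to the total weight. As
  admissible outcomes have bounded total weight, this limits the size of a fingerprint.\<close>

lemma total_scan:
  "distinct vs \<Longrightarrow> sum F (Pow V) + \<theta> * real (card (picks X vs F)) \<le> sum (scan X vs F) (Pow V)"
proof (induction vs arbitrary: F)
  case (Cons v vs)
  show ?case
  proof (cases "v \<in> X \<and> gain F v \<ge> \<theta>")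
    case True
    let ?F = "\<lambda>Y. F Y + link F v Y"
    have "card (picks X (v # vs) F) \<le> Suc (card (picks X vs ?F))"
      using True card_insert_le_m1[of "Suc (card (picks X vs ?F))" "picks X vs ?F" v] by simp
    then have "\<theta> * real (card (picks X (v # vs) F)) \<le> \<theta> * (1 + real (card (picks X vs ?F)))"
      using theta by (intro mult_left_mono) auto
    moreover have "sum ?F (Pow V) = sum F (Pow V) + gain F v"
      by (simp add: sum.distrib gain_def)
    moreover have "sum ?F (Pow V) + \<theta> * real (card (picks X vs ?F)) \<le> sum (scan X vs ?F) (Pow V)"
      using Cons by simp
    moreover have "scan X (v # vs) F = scan X vs ?F" using True by simp
    ultimately show ?thesis using True by (simp add: algebra_simps)
  next
    case False
    then show ?thesis using Cons by auto
  qed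
qed simp

text \<open>With \<open>2 * D * \<tau>\<close> in the role of \<open>D\<close> this is the degree
  condition of the locale for uniformity \<open>t\<close>, so the outcome of a scan is fit for the
  induction.\<close>

definition admissible :: "('v set \<Rightarrow> real) \<Rightarrow> bool" where
  "admissible F \<longleftrightarrow> uniform_weight V t F \<and>
     (\<forall>T. T \<noteq> {} \<longrightarrow> T \<subseteq> V \<longrightarrow> wdeg V F T \<le> 2 * D * \<tau> ^ card T)"

lemma sum_link_le_wdeg:
  assumes "v \<in> V" "v \<notin> T"
  shows "(\<Sum>Y | Y \<subseteq> V \<and> T \<subseteq> Y. link F v Y) \<le> wdeg V w (insert v T)"
proof -
  have "(\<Sum>Y | Y \<subseteq> V \<and> T \<subseteq> Y. link F v Y) = (\<Sum>Y | Y \<subseteq> V \<and> T \<subseteq> Y \<and> v \<notin> Y. link F v Y)"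
    using V by (intro sum.mono_neutral_right) (auto simp: link_def)
  also have "\<dots> \<le> (\<Sum>Y | Y \<subseteq> V \<and> T \<subseteq> Y \<and> v \<notin> Y. w (insert v Y))"
    by (intro sum_mono) (auto simp: link_def uniform_weightD(1)[OF w])
  also have "\<dots> = sum w (insert v ` {Y. Y \<subseteq> V \<and> T \<subseteq> Y \<and> v \<notin> Y})"
    by (subst sum.reindex) (auto simp: inj_on_def insert_ident)
  also have "\<dots> \<le> wdeg V w (insert v T)"
    unfolding wdeg_def using V assms uniform_weightD(1)[OF w] by (intro sum_mono2) auto
  finally show ?thesis .
qed

lemma gain_le: "v \<in> V \<Longrightarrow> gain F v \<le> D"
  using sum_link_le_wdeg[of v "{}" F] deg[of "{v}"] by (simp add: gain_def Pow_def)

lemma admissible_add_link: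
  assumes F: "admissible F" and v: "v \<in> V"
  shows "admissible (\<lambda>Y. F Y + link F v Y)"
  unfolding admissible_def
proof (intro conjI allI impI)
  have uF: "uniform_weight V t F" using F by (simp add: admissible_def)
  have "Y \<subseteq> V \<and> card Y = t" if "link F v Y \<noteq> 0" for Y
  proof -
    have *: "v \<notin> Y" "w (insert v Y) \<noteq> 0" using that by (auto simp: link_def split: if_splits)
    have "insert v Y \<subseteq> V" "card (insert v Y) = Suc t" using uniform_weightD[OF w] * by blast+
    then show ?thesis using * V by (metis card_insert_disjoint diff_Suc_1 finite_subset insert_subset)
  qed
  then show "uniform_weight V t (\<lambda>Y. F Y + link F v Y)"
    using uF link_nonneg unfolding uniform_weight_def
    by (metis add.right_neutral add_nonneg_nonneg)
  fix T assume T: "T \<noteq> {}" "T \<subseteq> V"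
  have eq: "wdeg V (\<lambda>Y. F Y + link F v Y) T = wdeg V F T + (\<Sum>Y | Y \<subseteq> V \<and> T \<subseteq> Y. link F v Y)"
    by (simp add: wdeg_def sum.distrib)
  show "wdeg V (\<lambda>Y. F Y + link F v Y) T \<le> 2 * D * \<tau> ^ card T"
  proof (cases "saturated F T \<or> v \<in> T")
    case True
    \<comment> \<open>No edge of the link contains \<open>T\<close>: edges over saturated sets are
      left out, and a link at \<open>v\<close> avoids \<open>v\<close>.\<close>
    then have "(\<Sum>Y | Y \<subseteq> V \<and> T \<subseteq> Y. link F v Y) = 0"
      by (intro sum.neutral) (auto simp: link_def)
    with eq F T show ?thesis by (simp add: admissible_def)
  next
    case False
    then have "wdeg V F T \<le> D * \<tau> ^ card T" using T by (simp add: saturated_def)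
    moreover have "card (insert v T) - 1 = card T"
      using False V T finite_subset by fastforce
    then have "(\<Sum>Y | Y \<subseteq> V \<and> T \<subseteq> Y. link F v Y) \<le> D * \<tau> ^ card T"
      using sum_link_le_wdeg[of v T F] deg[of "insert v T"] False T v by fastforce
    ultimately show ?thesis using eq by linarith
  qed
qed

lemma admissible_scan: "admissible F \<Longrightarrow> set vs \<subseteq> V \<Longrightarrow> admissible (scan X vs F)"
  by (induction vs arbitrary: F) (auto intro: admissible_add_link)

text \<open>An edge \<open>Y\<close> inside \<open>X\<close> could only have entered through a
  picked \<open>v\<close> in \<open>X\<close>, and then \<open>insert v Y\<close> would be an edge
  of \<open>w\<close> inside \<open>X\<close>. Independence thus passes to the lower
  uniformity.\<close>

lemma scan_independent:
  assumes "\<And>Z. w Z \<noteq> 0 \<Longrightarrow> \<not> Z \<subseteq> X"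
  shows "(\<And>Y. F Y \<noteq> 0 \<Longrightarrow> \<not> Y \<subseteq> X) \<Longrightarrow> scan X vs F Y \<noteq> 0 \<Longrightarrow> \<not> Y \<subseteq> X"
proof (induction vs arbitrary: F Y)
  case (Cons v vs)
  define F' where "F' = (if v \<in> X \<and> gain F v \<ge> \<theta> then (\<lambda>Y. F Y + link F v Y) else F)"
  have "\<not> Y \<subseteq> X" if "F' Y \<noteq> 0" for Y
  proof (cases "F Y = 0")
    case True
    then have "v \<in> X" "w (insert v Y) \<noteq> 0"
      using that by (auto simp: F'_def link_def split: if_splits)
    then show ?thesis using assms[of "insert v Y"] by auto
  qed (use Cons.prems in auto)
  moreover have "scan X vs F' Y \<noteq> 0" using Cons.prems(2) unfolding F'_def scan.simps .
  ultimately show ?case using Cons.IH[of F' Y] by blast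
qed auto

text \<open>A light outcome has few saturated sets, so most edges of \<open>w\<close> avoid them all and
  many vertices still have a large gain; these vertices lie outside the container.\<close>

lemma card_low_gain:
  assumes F: "admissible F"
    and low: "2 ^ (t + 1) * sum F (Pow V) \<le> c * \<tau> * D * real (card V)"
    and tot: "sum w (Pow V) \<ge> c * D * real (card V)"
    and theta_eq: "\<theta> = c / 4 * D"
  shows "real (card {v\<in>V. gain F v < \<theta>}) \<le> (1 - c / 4) * real (card V)"
proof -
  define N where "N = real (card V)"
  define bad where "bad = {Z. Z \<subseteq> V \<and> (\<exists>T\<subseteq>Z. saturated F T)}"
  define sat where "sat = {T. T \<subseteq> V \<and> saturated F T}"
  have wnn: "w Z \<ge> 0" for Z using uniform_weightD(1)[OF w] .
  have uF: "uniform_weight V t F" using F by (simp add: admissible_def)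
  have fin: "finite bad" "finite sat" using V by (auto simp: bad_def sat_def)
  \<comment> \<open>The bad weight is charged to the saturated sets. On these the degree in
    \<open>w\<close> is at most the degree in \<open>F\<close> divided by \<open>\<tau>\<close>, so
    lightness of \<open>F\<close> bounds it by \<open>c / 2 * D * N\<close>, half of what
    \<open>tot\<close> guarantees.\<close>
  have "sum w bad \<le> (\<Sum>Z\<in>bad. \<Sum>T\<in>sat. if T \<subseteq> Z then w Z else 0)"
  proof (rule sum_mono)
    fix Z assume "Z \<in> bad"
    then obtain T where T: "T \<in> sat" "T \<subseteq> Z" by (auto simp: bad_def sat_def)
    then have "(if T \<subseteq> Z then w Z else 0) \<le> (\<Sum>T\<in>sat. if T \<subseteq> Z then w Z else 0)"
      using fin wnn by (intro member_le_sum) auto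
    with T show "w Z \<le> (\<Sum>T\<in>sat. if T \<subseteq> Z then w Z else 0)" by simp
  qed
  also have "\<dots> \<le> (\<Sum>Z\<in>Pow V. \<Sum>T\<in>sat. if T \<subseteq> Z then w Z else 0)"
    using V wnn by (intro sum_mono2) (auto simp: bad_def intro: sum_nonneg)
  also have "\<dots> = (\<Sum>T\<in>sat. \<Sum>Z\<in>Pow V. if T \<subseteq> Z then w Z else 0)"
    by (rule sum.swap)
  also have "\<dots> = (\<Sum>T\<in>sat. wdeg V w T)"
    unfolding wdeg_def using V by (intro sum.cong refl sum.mono_neutral_cong_right) auto
  also have "\<dots> \<le> (\<Sum>T\<in>sat. wdeg V F T / \<tau>)"
  proof (rule sum_mono)
    fix T assume "T \<in> sat"
    then have T: "T \<noteq> {}" "T \<subseteq> V" "wdeg V F T > D * \<tau> ^ card T"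
      by (auto simp: sat_def saturated_def)
    then have "card T > 0" using V by (auto simp: card_gt_0_iff finite_subset)
    then have "D * \<tau> ^ (card T - 1) = D * \<tau> ^ card T / \<tau>"
      using tau by (cases "card T") auto
    with deg[OF T(1,2)] have "wdeg V w T \<le> D * \<tau> ^ card T / \<tau>" by simp
    also have "\<dots> \<le> wdeg V F T / \<tau>" using T(3) tau by (intro divide_right_mono) auto
    finally show "wdeg V w T \<le> wdeg V F T / \<tau>" .
  qed
  also have "\<dots> \<le> (\<Sum>T\<in>Pow V. wdeg V F T / \<tau>)"
    using V tau wdeg_nonneg[OF uF] by (intro sum_mono2) (auto simp: sat_def)
  also have "\<dots> = 2 ^ t * sum F (Pow V) / \<tau>"
    by (simp add: sum_divide_distrib[symmetric] sum_wdeg_subsets[OF V uF])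
  also have "\<dots> \<le> c / 2 * D * N"
    using low tau by (simp add: field_simps N_def)
  finally have bad: "sum w bad \<le> c / 2 * D * N" .
  define good where "good = {Z. Z \<subseteq> V \<and> Z \<notin> bad \<and> Z \<noteq> {}}"
  have "w {} = 0" using uniform_weightD(3)[OF w, of "{}"] by fastforce
  have "bad \<subseteq> Pow V" by (auto simp: bad_def)
  have "sum w (Pow V) = sum w bad + sum w (Pow V - bad)"
    using V sum.subset_diff[of bad "Pow V" w] \<open>bad \<subseteq> Pow V\<close> by simp
  also have "sum w (Pow V - bad) = sum w good"
    using V \<open>w {} = 0\<close> by (intro sum.mono_neutral_right) (auto simp: good_def)
  finally have good: "sum w good \<ge> c / 2 * D * N" using bad tot unfolding N_def by linarith
  \<comment> \<open>Each good edge is assigned to one of its vertices, so none is counted twice;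
    containing no saturated set, it survives in the link of that vertex.\<close>
  define h where "h Z = (SOME v. v \<in> Z)" for Z :: "'v set"
  have h: "h Z \<in> Z" if "Z \<in> good" for Z
    using that unfolding h_def good_def by (auto intro: someI_ex)
  then have "h Z \<in> V" if "Z \<in> good" for Z
    using that by (auto simp: good_def)
  have "sum w good \<le> (\<Sum>Z\<in>good. link F (h Z) (Z - {h Z}))"
  proof (rule sum_mono)
    fix Z assume Z: "Z \<in> good"
    then have "\<forall>T\<subseteq>Z - {h Z}. \<not> saturated F T" by (auto simp: good_def bad_def)
    then show "w Z \<le> link F (h Z) (Z - {h Z})" using h[OF Z] by (simp add: link_def insert_absorb)
  qed
  also have "\<dots> = (\<Sum>(v, Y)\<in>(\<lambda>Z. (h Z, Z - {h Z})) ` good. link F v Y)"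
  proof (subst sum.reindex)
    show "inj_on (\<lambda>Z. (h Z, Z - {h Z})) good"
      using h by (intro inj_onI) (metis Pair_inject insert_Diff)
  qed simp
  also have "\<dots> \<le> (\<Sum>(v, Y)\<in>V \<times> Pow V. link F v Y)"
    using V link_nonneg \<open>\<And>Z. Z \<in> good \<Longrightarrow> h Z \<in> V\<close>
    by (intro sum_mono2) (auto simp: good_def)
  also have "\<dots> = (\<Sum>v\<in>V. gain F v)"
    by (simp add: gain_def sum.cartesian_product)
  \<comment> \<open>Vertices of low gain contribute at most \<open>N * \<theta>\<close>, which is
    \<open>c / 4 * D * N\<close>. The remaining \<open>c / 4 * D * N\<close> must come from vertices
    contributing at most \<open>D\<close> each, so at least \<open>c / 4 * N\<close> of them have
    high gain.\<close>
  also have "\<dots> \<le> (\<Sum>v\<in>V. if gain F v < \<theta> then \<theta> else D)"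
    using gain_le by (intro sum_mono) auto
  also have "\<dots> = real (card {v\<in>V. gain F v < \<theta>}) * \<theta> + real (card {v\<in>V. \<not> gain F v < \<theta>}) * D"
    using V by (simp add: sum.If_cases Int_def)
  finally have 1: "c / 2 * D * N \<le> real (card {v\<in>V. gain F v < \<theta>}) * \<theta>
      + real (card {v\<in>V. \<not> gain F v < \<theta>}) * D" using good by linarith
  have 2: "N = real (card {v\<in>V. gain F v < \<theta>}) + real (card {v\<in>V. \<not> gain F v < \<theta>})"
    unfolding N_def of_nat_add[symmetric] using V
    by (subst card_Un_disjoint[symmetric]) (auto intro!: arg_cong[where f = card])
  have "real (card {v\<in>V. gain F v < \<theta>}) * \<theta> \<le> N * \<theta>"
    using 2 theta by (intro mult_right_mono) auto
  then have "c / 4 * N * D \<le> real (card {v\<in>V. \<not> gain F v < \<theta>}) * D"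
    using 1 unfolding theta_eq by (simp add: algebra_simps)
  then have "c / 4 * N \<le> real (card {v\<in>V. \<not> gain F v < \<theta>})" using D by simp
  then show ?thesis using 2 unfolding N_def by (simp add: algebra_simps)
qed

end


section \<open>Containers by induction on the uniformity\<close>

lemma finite_small_subsets: "finite V \<Longrightarrow> finite (small_subsets V k)"
  by (rule finite_subset[of _ "Pow V"]) (auto simp: small_subsets_def)

lemma small_subsets_mono: "k \<le> l \<Longrightarrow> small_subsets V k \<subseteq> small_subsets V l"
  by (auto simp: small_subsets_def)

lemma card_small_subsets_mono:
  "finite V \<Longrightarrow> k \<le> l \<Longrightarrow> card (small_subsets V k) \<le> card (small_subsets V l)"
  by (intro card_mono finite_small_subsets small_subsets_mono)

lemma card_small_subsets_pos:
  assumes "finite V" "k \<ge> 0" shows "card (small_subsets V k) > 0"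
proof -
  have "{} \<in> small_subsets V k" using assms by (simp add: small_subsets_def)
  then show ?thesis using assms finite_small_subsets by (metis card_gt_0_iff empty_iff)
qed

text \<open>The family \<open>\<I>\<close> is arbitrary so that the induction on the uniformity can be applied to the
  members of \<open>\<I>\<close> with a common fingerprint, while \<open>\<J>\<close> is down-closed so that the
  fingerprint can be removed from each of them.\<close>

definition container_bound :: "'v itself \<Rightarrow> nat \<Rightarrow> real \<Rightarrow> real \<Rightarrow> real \<Rightarrow> bool" where
  "container_bound _ s c \<delta> A \<longleftrightarrow>
     (\<forall>(V :: 'v set) w D \<tau> \<I> \<J> M.
        finite V \<longrightarrow> uniform_weight V s w \<longrightarrow> D > 0 \<longrightarrow> \<tau> > 0 \<longrightarrow>
        (\<forall>T. T \<noteq> {} \<longrightarrow> T \<subseteq> V \<longrightarrow> wdeg V w T \<le> D * \<tau> ^ (card T - 1)) \<longrightarrow>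
        sum w (Pow V) \<ge> c * D * real (card V) \<longrightarrow>
        \<I> \<subseteq> \<J> \<longrightarrow> \<J> \<subseteq> Pow V \<longrightarrow> (\<forall>I\<in>\<J>. \<forall>I'\<subseteq>I. I' \<in> \<J>) \<longrightarrow>
        (\<forall>I\<in>\<I>. \<forall>Z. w Z \<noteq> 0 \<longrightarrow> \<not> Z \<subseteq> I) \<longrightarrow>
        (\<forall>C\<subseteq>V. real (card C) \<le> (1 - \<delta>) * real (card V) \<longrightarrow> card {I\<in>\<J>. I \<subseteq> C} \<le> M) \<longrightarrow>
        card \<I> \<le> card (small_subsets V (A * \<tau> * real (card V))) ^ s * M)"

text \<open>In uniformity 1 the vertices of zero weight form a single container for all of
  \<open>\<I>\<close>, and the degree bound makes it small. The cap \<open>1/2\<close> keeps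
  \<open>\<delta>\<close> below 1.\<close>

lemma container_bound_one:
  assumes c: "c > 0"
  shows "container_bound TYPE('v) 1 c (min c (1/2)) 1"
  unfolding container_bound_def
proof (intro allI impI)
  fix V :: "'v set" and w and D \<tau> :: real and \<I> \<J> and M :: nat
  assume V: "finite V" and w: "uniform_weight V 1 w" and D: "D > 0" and tau: "\<tau> > 0"
    and deg: "\<forall>T. T \<noteq> {} \<longrightarrow> T \<subseteq> V \<longrightarrow> wdeg V w T \<le> D * \<tau> ^ (card T - 1)"
    and tot: "sum w (Pow V) \<ge> c * D * real (card V)"
    and IJ: "\<I> \<subseteq> \<J>" and J: "\<J> \<subseteq> Pow V"
    and ind: "\<forall>I\<in>\<I>. \<forall>Z. w Z \<noteq> 0 \<longrightarrow> \<not> Z \<subseteq> I"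
    and M: "\<forall>C\<subseteq>V. real (card C) \<le> (1 - min c (1/2)) * real (card V) \<longrightarrow> card {I\<in>\<J>. I \<subseteq> C} \<le> M"
  define C where "C = {x\<in>V. w {x} = 0}"
  have nn: "w Z \<ge> 0" for Z using uniform_weightD(1)[OF w] .
  have "c * D * real (card V) \<le> (\<Sum>x\<in>V. wdeg V w {x})"
    using tot total_le_sum_wdeg[OF V w] by simp
  also have "\<dots> \<le> (\<Sum>x\<in>V. if x \<in> C then 0 else D)"
  proof (rule sum_mono)
    fix x assume x: "x \<in> V"
    have "wdeg V w {x} = 0" if "x \<in> C"
      unfolding wdeg_def
    proof (rule sum.neutral, safe)
      fix Z assume "{x} \<subseteq> Z"
      show "w Z = 0"
      proof (rule ccontr)
        assume "w Z \<noteq> 0"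
        then have "card Z = 1" using uniform_weightD(3)[OF w] by blast
        then have "Z = {x}" using \<open>{x} \<subseteq> Z\<close> by (metis card_1_singletonE subset_singletonD insert_not_empty)
        then show False using that \<open>w Z \<noteq> 0\<close> by (simp add: C_def)
      qed
    qed
    moreover have "wdeg V w {x} \<le> D" using deg[rule_format, of "{x}"] x by simp
    ultimately show "wdeg V w {x} \<le> (if x \<in> C then 0 else D)" by simp
  qed
  also have "\<dots> = real (card (V - C)) * D"
    using V by (simp add: sum.If_cases set_diff_eq Int_def)
  also have "real (card (V - C)) = real (card V) - real (card C)"
    using V by (simp add: C_def card_Diff_subset of_nat_diff card_mono)
  finally have "c * real (card V) \<le> real (card V) - real (card C)"
    using D by (simp add: mult.commute mult.left_commute)
  moreover have "min c (1/2) * real (card V) \<le> c * real (card V)" by (intro mult_right_mono) auto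
  ultimately have "real (card C) \<le> (1 - min c (1/2)) * real (card V)" by (simp add: algebra_simps)
  then have CM: "card {I\<in>\<J>. I \<subseteq> C} \<le> M" using M by (simp add: C_def)
  have "finite \<J>" using J V by (meson finite_Pow_iff finite_subset)
  have "\<I> \<subseteq> {I\<in>\<J>. I \<subseteq> C}" using IJ J ind unfolding C_def by fastforce
  then have "card \<I> \<le> card {I\<in>\<J>. I \<subseteq> C}" using \<open>finite \<J>\<close> by (intro card_mono) auto
  also have "\<dots> \<le> M" by (rule CM)
  also have "\<dots> \<le> card (small_subsets V (1 * \<tau> * real (card V))) ^ 1 * M"
    using card_small_subsets_pos[OF V, of "1 * \<tau> * real (card V)"] tau by simp
  finally show "card \<I> \<le> card (small_subsets V (1 * \<tau> * real (card V))) ^ 1 * M" .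
qed

text \<open>The members of \<open>\<I>\<close> are sorted by fingerprint \<open>S\<close>. If
  \<open>F S\<close> is light, \<open>card_low_gain\<close> gives a container directly; if it is
  heavy, the induction hypothesis applies to it. The choice of \<open>S\<close> costs one factor
  \<open>B\<close>, and \<open>B ^ t\<close> covers each class.\<close>

lemma container_bound_Suc:
  assumes t: "t > 0" and c: "c > 0" and A: "A \<ge> 0"
    and IH: "container_bound TYPE('v) t (c / 2 ^ (t + 2)) \<delta> A"
  shows "container_bound TYPE('v) (Suc t) c (min (c / 4) \<delta>) (max (8 / c) A)"
  unfolding container_bound_def
proof (intro allI impI)
  fix V :: "'v set" and w and D \<tau> :: real and \<I> \<J> and M :: nat
  assume V: "finite V" and w: "uniform_weight V (Suc t) w" and D: "D > 0" and tau: "\<tau> > 0"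
    and deg: "\<forall>T. T \<noteq> {} \<longrightarrow> T \<subseteq> V \<longrightarrow> wdeg V w T \<le> D * \<tau> ^ (card T - 1)"
    and tot: "sum w (Pow V) \<ge> c * D * real (card V)"
    and IJ: "\<I> \<subseteq> \<J>" and J: "\<J> \<subseteq> Pow V" and down: "\<forall>I\<in>\<J>. \<forall>I'\<subseteq>I. I' \<in> \<J>"
    and ind: "\<forall>I\<in>\<I>. \<forall>Z. w Z \<noteq> 0 \<longrightarrow> \<not> Z \<subseteq> I"
    and M: "\<forall>C\<subseteq>V. real (card C) \<le> (1 - min (c / 4) \<delta>) * real (card V) \<longrightarrow> card {I\<in>\<J>. I \<subseteq> C} \<le> M"
  define N where "N = real (card V)"
  define A' where "A' = max (8 / c) A"
  define B where "B = card (small_subsets V (A' * \<tau> * N))"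
  interpret link_scan V w t D \<tau> "c / 4 * D"
    using V w t D tau c deg by unfold_locales auto
  obtain vs where vs: "set vs = V" "distinct vs" using finite_distinct_list[OF V] by blast
  define P where "P I = picks I vs (\<lambda>_. 0)" for I
  define F where "F S = scan S vs (\<lambda>_. 0)" for S
  have A'nn: "A' \<ge> 0" using A by (simp add: A'_def)
  have B: "B \<ge> 1" unfolding B_def N_def
    using card_small_subsets_pos[OF V, of "A' * \<tau> * real (card V)"] tau A'nn by simp
  have F_P: "F (P I) = F I" for I unfolding F_def P_def by (rule scan_picks[OF vs(2)])
  have adm: "admissible (F S)" for S
    unfolding F_def using vs tau D
    by (intro admissible_scan) (auto simp: admissible_def uniform_weight_def wdeg_def)
  have finJ: "finite \<J>" using J V by (meson finite_Pow_iff finite_subset)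
  then have finI: "finite \<I>" using IJ finite_subset by blast
  have P_sub: "P I \<subseteq> I \<inter> V" for I using picks_subset[of I vs] by (simp add: P_def vs(1))
  have totF: "sum (F S) (Pow V) \<le> 2 * D * \<tau> * N" for S
  proof -
    have "sum (F S) (Pow V) \<le> (\<Sum>x\<in>V. wdeg V (F S) {x})"
      using adm t by (intro total_le_sum_wdeg[OF V]) (auto simp: admissible_def)
    also have "\<dots> \<le> (\<Sum>x\<in>V. 2 * D * \<tau>)"
      using adm[of S] by (intro sum_mono) (auto simp: admissible_def dest!: spec[of _ "{_}"])
    finally show ?thesis by (simp add: N_def mult.commute)
  qed
  \<comment> \<open>Each pick gains at least \<open>c / 4 * D\<close> and the total is at most
    \<open>2 * D * \<tau> * N\<close>; the quotient is the source of \<open>8 / c\<close>.\<close>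
  have P_small: "P I \<in> small_subsets V (A' * \<tau> * N)" for I
  proof -
    have "c / 4 * D * real (card (P I)) \<le> 2 * D * \<tau> * N"
      using total_scan[OF vs(2), of "\<lambda>_. 0" I] totF[of I] by (simp add: P_def F_def)
    then have "D * (c * real (card (P I))) \<le> D * (8 * (\<tau> * N))" by (simp add: algebra_simps)
    then have "real (card (P I)) \<le> 8 / c * (\<tau> * N)" using c D by (simp add: field_simps)
    also have "\<dots> \<le> A' * (\<tau> * N)"
      using tau by (intro mult_right_mono) (auto simp: A'_def N_def)
    finally show ?thesis using P_sub[of I] by (auto simp: small_subsets_def mult.assoc)
  qed
  have class_le: "card {I\<in>\<I>. P I = S} \<le> B ^ t * M" for S
  proof (cases "2 ^ (t + 1) * sum (F S) (Pow V) \<le> c * \<tau> * D * N")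
    case True
    define C where "C = {v\<in>V. gain (F S) v < c / 4 * D}"
    have "real (card C) \<le> (1 - c / 4) * N"
      unfolding C_def N_def using adm True tot by (intro card_low_gain) (auto simp: N_def)
    also have "\<dots> \<le> (1 - min (c / 4) \<delta>) * N"
      by (intro mult_right_mono) (auto simp: N_def)
    finally have CM: "card {I\<in>\<J>. I \<subseteq> C} \<le> M" using M unfolding N_def by (simp add: C_def)
    have rest: "I - S \<subseteq> C" if "I \<in> \<I>" "P I = S" for I
    proof
      fix v assume v: "v \<in> I - S"
      then have "v \<in> V" using that IJ J by blast
      moreover have "gain (F I) v < c / 4 * D"
        unfolding F_def using v that \<open>v \<in> V\<close> vs by (intro gain_scan_less) (auto simp: P_def)
      ultimately show "v \<in> C" using F_P[of I] that by (simp add: C_def)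
    qed
    \<comment> \<open>Every \<open>I\<close> in the class contains \<open>S\<close>, so removing
      \<open>S\<close> loses no information. The remainder lies in \<open>C\<close> and, as
      \<open>\<J>\<close> is down-closed, is counted by \<open>M\<close>.\<close>
    have "inj_on (\<lambda>I. I - S) {I\<in>\<I>. P I = S}"
    proof (rule inj_onI)
      fix I I' assume "I \<in> {I\<in>\<I>. P I = S}" "I' \<in> {I\<in>\<I>. P I = S}" "I - S = I' - S"
      then show "I = I'" using P_sub[of I] P_sub[of I'] by blast
    qed
    moreover have "(\<lambda>I. I - S) ` {I\<in>\<I>. P I = S} \<subseteq> {I\<in>\<J>. I \<subseteq> C}"
      using rest down IJ by blast
    ultimately have "card {I\<in>\<I>. P I = S} \<le> card {I\<in>\<J>. I \<subseteq> C}"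
      using finJ by (intro card_inj_on_le) auto
    also have "\<dots> \<le> M" by (rule CM)
    also have "\<dots> \<le> B ^ t * M" using B by simp
    finally show ?thesis .
  next
    case False
    \<comment> \<open>The density becomes \<open>c / 2 ^ (t + 2)\<close> because the failed
      inequality is measured against the new degree scale \<open>2 * D * \<tau>\<close>. All members
      of the class produce the same \<open>F S\<close>, so each is independent in it.\<close>
    have "card {I\<in>\<I>. P I = S} \<le> card (small_subsets V (A * \<tau> * real (card V))) ^ t * M"
    proof (rule IH[unfolded container_bound_def, rule_format])
      show "finite V" "uniform_weight V t (F S)" "0 < 2 * D * \<tau>" "0 < \<tau>"
        using V adm[of S] D tau by (auto simp: admissible_def)
      show "wdeg V (F S) T \<le> 2 * D * \<tau> * \<tau> ^ (card T - 1)" if "T \<noteq> {}" "T \<subseteq> V" for T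
      proof -
        have "card T > 0" using that V by (auto simp: card_gt_0_iff finite_subset)
        then have "\<tau> * \<tau> ^ (card T - 1) = \<tau> ^ card T" by (metis Suc_pred' power_Suc)
        then show ?thesis using adm[of S] that by (simp add: admissible_def mult.assoc)
      qed
      show "c / 2 ^ (t + 2) * (2 * D * \<tau>) * real (card V) \<le> sum (F S) (Pow V)"
        using False by (simp add: N_def field_simps)
      show "{I\<in>\<I>. P I = S} \<subseteq> \<J>" "\<J> \<subseteq> Pow V" using IJ J by auto
      show "I' \<in> \<J>" if "I \<in> \<J>" "I' \<subseteq> I" for I I' using that down by blast
      show "\<not> Z \<subseteq> I" if "I \<in> {I\<in>\<I>. P I = S}" "F S Z \<noteq> 0" for I Z
      proof -
        have nz: "scan I vs (\<lambda>_. 0) Z \<noteq> 0" using that F_P[of I] by (auto simp: F_def)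
        have "\<not> Z' \<subseteq> I" if "w Z' \<noteq> 0" for Z' using that ind \<open>I \<in> {I\<in>\<I>. P I = S}\<close> by blast
        then show ?thesis by (rule scan_independent[OF _ _ nz]) simp_all
      qed
      show "card {I\<in>\<J>. I \<subseteq> C} \<le> M"
        if "C \<subseteq> V" "real (card C) \<le> (1 - \<delta>) * real (card V)" for C
      proof -
        have "(1 - \<delta>) * real (card V) \<le> (1 - min (c / 4) \<delta>) * real (card V)"
          by (intro mult_right_mono) auto
        then show ?thesis using that M by force
      qed
    qed
    also have "\<dots> \<le> B ^ t * M"
      unfolding B_def using V tau
      by (intro mult_right_mono power_mono card_small_subsets_mono)
        (auto simp: A'_def N_def intro: mult_right_mono)
    finally show ?thesis .
  qed
  have "\<I> = (\<Union>S\<in>small_subsets V (A' * \<tau> * N). {I\<in>\<I>. P I = S})" using P_small by auto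
  then have "card \<I> \<le> (\<Sum>S\<in>small_subsets V (A' * \<tau> * N). card {I\<in>\<I>. P I = S})"
    by (metis card_UN_le finite_small_subsets[OF V])
  also have "\<dots> \<le> B * (B ^ t * M)"
    unfolding B_def using sum_bounded_above[OF class_le, unfolded B_def] by simp
  finally show "card \<I> \<le> card (small_subsets V (max (8 / c) A * \<tau> * real (card V))) ^ Suc t * M"
    by (simp add: B_def A'_def N_def)
qed

text \<open>The density \<open>c\<close> is generalised in the induction because each step lowers
  it.\<close>

lemma container_bound_exists:
  assumes "s > 0" "c > 0"
  shows "\<exists>\<delta> A. 0 < \<delta> \<and> \<delta> < 1 \<and> A > 0 \<and> container_bound TYPE('v) s c \<delta> A"
  using assms
proof (induction s arbitrary: c rule: nat_induct_non_zero)
  case 1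
  then show ?case using container_bound_one[of c] by (intro exI[of _ "min c (1/2)"] exI[of _ 1]) auto
next
  case (Suc t)
  from Suc.IH[of "c / 2 ^ (t + 2)"] Suc.prems obtain \<delta> A where
    *: "0 < \<delta>" "\<delta> < 1" "A > 0" "container_bound TYPE('v) t (c / 2 ^ (t + 2)) \<delta> A" by auto
  have "container_bound TYPE('v) (Suc t) c (min (c / 4) \<delta>) (max (8 / c) A)"
    using container_bound_Suc[OF Suc.hyps Suc.prems _ *(4)] *(3) by simp
  then show ?case using * Suc.prems
    by (intro exI[of _ "min (c / 4) \<delta>"] exI[of _ "max (8 / c) A"]) auto
qed

section \<open>Balanced supersaturation\<close>

lemma card_supersets:
  assumes V: "finite V" and U: "U \<subseteq> V" and m: "card U \<le> m"
  shows "card {R. R \<subseteq> V \<and> card R = m \<and> U \<subseteq> R} = (card V - card U) choose (m - card U)"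
proof -
  have fU: "finite U" using V U finite_subset by blast
  have "bij_betw (\<lambda>R. R - U) {R. R \<subseteq> V \<and> card R = m \<and> U \<subseteq> R}
          {S. S \<subseteq> V - U \<and> card S = m - card U}"
  proof (rule bij_betw_byWitness[of _ "\<lambda>S. S \<union> U"])
    show "(\<lambda>S. S \<union> U) ` {S. S \<subseteq> V - U \<and> card S = m - card U}
        \<subseteq> {R. R \<subseteq> V \<and> card R = m \<and> U \<subseteq> R}"
    proof (clarify, intro conjI)
      fix S assume S: "S \<subseteq> V - U" "card S = m - card U"
      then have "card (S \<union> U) = card S + card U"
        using V fU by (intro card_Un_disjoint) (auto intro: finite_subset)
      then show "card (S \<union> U) = m" using S m by simp
    qed (use U in auto)
  qed (auto simp: card_Diff_subset[OF fU])
  then show ?thesis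
    using n_subsets[of "V - U" "m - card U"] V U fU
    by (simp add: bij_betw_same_card card_Diff_subset)
qed

lemma binomial_ratio_step:
  assumes "j < m" "m \<le> n"
  shows "real (n - j) * real ((n - Suc j) choose (m - Suc j)) =
         real (m - j) * real ((n - j) choose (m - j))"
proof -
  have "n - j = Suc (n - Suc j)" "m - j = Suc (m - Suc j)" using assms by auto
  then have "(n - j) * ((n - Suc j) choose (m - Suc j)) = (m - j) * ((n - j) choose (m - j))"
    using Suc_times_binomial[of "m - Suc j" "n - Suc j"] by simp
  then show ?thesis by (metis of_nat_mult)
qed

text \<open>In sampling terms: \<open>k\<close> given points fall into a random \<open>m\<close>-set
  with probability at most \<open>(m / n) ^ k\<close>, because each factor
  \<open>(m - j) / (n - j)\<close> is at most \<open>m / n\<close>.\<close>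

lemma binomial_ratio_le:
  assumes "m \<le> n" "k \<le> m"
  shows "real ((n - k) choose (m - k)) \<le> real (n choose m) * (real m / real n) ^ k"
  using assms(2)
proof (induction k)
  case (Suc j)
  then have j: "j < m" by simp
  then have pos: "real (n - j) > 0" "real n > 0" using assms by auto
  have "real ((n - Suc j) choose (m - Suc j))
      = real (m - j) / real (n - j) * real ((n - j) choose (m - j))"
    using binomial_ratio_step[OF j assms(1)] pos by (simp add: field_simps)
  also have "\<dots> \<le> real m / real n * real ((n - j) choose (m - j))"
  proof (rule mult_right_mono)
    have "real (m - j) * real n \<le> real m * real (n - j)"
      using j assms by (simp add: of_nat_diff algebra_simps mult_left_mono)
    then show "real (m - j) / real (n - j) \<le> real m / real n"
      using pos by (simp add: field_simps)
  qed simp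
  also have "\<dots> \<le> real m / real n * (real (n choose m) * (real m / real n) ^ j)"
    using Suc by (intro mult_left_mono) auto
  finally show ?case by (simp add: algebra_simps)
qed simp

lemma card_supersets_le:
  assumes V: "finite V" and U: "U \<subseteq> V" and m: "m \<le> card V"
  shows "real (card {R. R \<subseteq> V \<and> card R = m \<and> U \<subseteq> R})
     \<le> real (card V choose m) * (real m / real (card V)) ^ card U"
proof (cases "card U \<le> m")
  case True
  then show ?thesis using card_supersets[OF V U True] binomial_ratio_le[OF m True] by simp
next
  case False
  have "card U \<le> card R" if "R \<subseteq> V" "U \<subseteq> R" for R
    by (rule card_mono[OF finite_subset[OF that(1) V] that(2)])
  then have "{R. R \<subseteq> V \<and> card R = m \<and> U \<subseteq> R} = {}" using False by auto
  then have "card {R. R \<subseteq> V \<and> card R = m \<and> U \<subseteq> R} = 0" by (simp only: card.empty)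
  then show ?thesis by (simp only: of_nat_0) simp
qed

text \<open>Edges must survive sampling, so pairs need a matching lower bound; the loss of a factor
  2 comes from \<open>m - 1 \<ge> m / 2\<close>.\<close>

lemma card_supersets_pair_ge:
  assumes V: "finite V" and U: "U \<subseteq> V" "card U = 2" and m: "2 \<le> m" "m \<le> card V"
  shows "real (card {R. R \<subseteq> V \<and> card R = m \<and> U \<subseteq> R})
     \<ge> real (card V choose m) * (real m / real (card V))\<^sup>2 / 2"
proof -
  define n where "n = card V"
  have n: "m \<le> n" "n \<ge> 2" using m by (auto simp: n_def)
  have 1: "real (n - 1) * real ((n - 2) choose (m - 2)) = real (m - 1) * real ((n - 1) choose (m - 1))"
    using binomial_ratio_step[of 1 m n] n m by (simp add: numeral_2_eq_2)
  have 2: "real n * real ((n - 1) choose (m - 1)) = real m * real (n choose m)"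
    using binomial_ratio_step[of 0 m n] n m by simp
  have "real ((n - 2) choose (m - 2)) * (real (n - 1) * real n)
      = real n * (real (n - 1) * real ((n - 2) choose (m - 2)))" by (simp only: ac_simps)
  also have "\<dots> = real (m - 1) * (real n * real ((n - 1) choose (m - 1)))"
    unfolding 1 by (simp only: ac_simps)
  also have "\<dots> = real (m - 1) * real m * real (n choose m)" unfolding 2 by (simp only: ac_simps)
  finally have "real ((n - 2) choose (m - 2)) * (real (n - 1) * real n)
      = real (m - 1) * real m * real (n choose m)" .
  then have eq: "real ((n - 2) choose (m - 2))
      = real (m - 1) * real m / (real (n - 1) * real n) * real (n choose m)"
    using n by (simp add: field_simps)
  have "real m / 2 * real m / (real n * real n) \<le> real (m - 1) * real m / (real (n - 1) * real n)"
    using m n by (intro frac_le mult_mono) auto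
  then have "(real m / real n)\<^sup>2 / 2 * real (n choose m) \<le> real ((n - 2) choose (m - 2))"
    unfolding eq by (intro mult_right_mono) (auto simp: power2_eq_square)
  then show ?thesis using card_supersets[OF V U(1), of m] U(2) m by (simp add: n_def mult.commute)
qed

text \<open>The factor \<open>p ^ v\<close> stands on the left because the exponent \<open>card (\<Union>T) - v\<close> is
  not positive.\<close>

definition spread :: "real \<Rightarrow> nat \<Rightarrow> 'v set set set \<Rightarrow> bool" where
  "spread p v \<H> \<longleftrightarrow>
     (\<forall>T. T \<noteq> {} \<longrightarrow> (\<exists>Q\<in>\<H>. T \<subseteq> Q) \<longrightarrow> real (card {Q\<in>\<H>. T \<subseteq> Q}) * p ^ v \<le> p ^ card (\<Union>T))"

text \<open>In a maximal spread family with few members the saturated edge sets are so rare that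
  deleting one edge from each of them leaves many edges in some set of \<open>m\<close> vertices.\<close>

lemma balanced_supersaturation:
  fixes E :: "'v set set" and \<Q> :: "'v set set set"
  assumes V: "finite V" and E: "E \<subseteq> {e. e \<subseteq> V \<and> card e = 2}"
    and m: "2 \<le> m" "m \<le> card V" and p: "p = real m / real (card V)"
    and Q: "\<And>Q. Q \<in> \<Q> \<Longrightarrow> Q \<subseteq> E \<and> card Q = r \<and> card (\<Union>Q) = v" and r: "r > 0"
    and dense: "\<And>R E'. R \<subseteq> V \<Longrightarrow> card R = m \<Longrightarrow> E' \<subseteq> E \<Longrightarrow> \<forall>e\<in>E'. e \<subseteq> R \<Longrightarrow> real (card E') > g
        \<Longrightarrow> \<exists>Q\<in>\<Q>. Q \<subseteq> E'"
    and g: "4 * g < p\<^sup>2 * real (card E)"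
  shows "\<exists>\<H>\<subseteq>\<Q>. spread p v \<H> \<and> real (card \<H>) * p ^ v \<ge> p\<^sup>2 * real (card E) / 2 ^ (r + 3)"
proof -
  have p0: "p > 0" and p1: "p \<le> 1" using m by (auto simp: p)
  have finE: "finite E" using E V by (intro finite_subset[of E "Pow V"]) auto
  have finQ: "finite \<Q>" using Q finE by (intro finite_subset[of \<Q> "Pow E"]) auto
  have "spread p v {}" by (simp add: spread_def)
  moreover have "card \<H> < Suc (card \<Q>)" if "\<H> \<subseteq> \<Q>" for \<H>
    using card_mono[OF finQ that] by simp
  ultimately have "\<exists>\<H>. (\<H> \<subseteq> \<Q> \<and> spread p v \<H>) \<and>
      (\<forall>\<H>'. \<H>' \<subseteq> \<Q> \<and> spread p v \<H>' \<longrightarrow> card \<H>' \<le> card \<H>)"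
    by (intro Lattices_Big.ex_has_greatest_nat[where k = "{}" and b = "Suc (card \<Q>)"]) auto
  then obtain \<H> where \<H>: "\<H> \<subseteq> \<Q>" "spread p v \<H>"
    and max: "\<And>\<H>'. \<H>' \<subseteq> \<Q> \<Longrightarrow> spread p v \<H>' \<Longrightarrow> card \<H>' \<le> card \<H>"
    by blast
  have fin\<H>: "finite \<H>" using \<H>(1) finQ finite_subset by blast
  have "real (card \<H>) * p ^ v \<ge> p\<^sup>2 * real (card E) / 2 ^ (r + 3)"
  proof (rule ccontr)
    assume "\<not> ?thesis"
    then have few: "2 ^ (r + 3) * (real (card \<H>) * p ^ v) < p\<^sup>2 * real (card E)"
      by (simp add: field_simps)
    define d where "d T = card {Q\<in>\<H>. T \<subseteq> Q}" for T
    \<comment> \<open>A saturated set cannot take one more member without violating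
      \<open>spread\<close>. Only sets below some member of \<open>\<H>\<close> are considered,
      which leaves at most \<open>2 ^ r\<close> per member.\<close>
    define Sat where "Sat = {T. T \<noteq> {} \<and> (\<exists>Q\<in>\<H>. T \<subseteq> Q) \<and> (real (d T) + 1) * p ^ v > p ^ card (\<Union>T)}"
    have SatE: "T \<subseteq> E" if "T \<in> Sat" for T using that \<H>(1) Q unfolding Sat_def by blast
    have finSat: "finite Sat" using SatE finE by (intro finite_subset[of Sat "Pow E"]) auto
    have UV: "\<Union>T \<subseteq> V" if "T \<subseteq> E" for T using that E by blast
    define \<R> where "\<R> = {R. R \<subseteq> V \<and> card R = m}"
    have finR: "finite \<R>" using V by (simp add: \<R>_def)
    have cardR: "card \<R> = card V choose m" unfolding \<R>_def using V by (rule n_subsets)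
    then have cardR0: "card \<R> > 0" using m by simp
    have "(\<Sum>T\<in>Sat. p ^ card (\<Union>T)) \<le> (\<Sum>T\<in>Sat. 2 * p ^ v * real (d T))"
    proof (rule sum_mono)
      fix T assume "T \<in> Sat"
      then obtain Q where T: "Q \<in> \<H>" "T \<subseteq> Q" "(real (d T) + 1) * p ^ v > p ^ card (\<Union>T)"
        by (auto simp: Sat_def)
      then have "d T > 0" using fin\<H> by (auto simp: d_def card_gt_0_iff)
      then have "(real (d T) + 1) * p ^ v \<le> (2 * real (d T)) * p ^ v"
        using p0 by (intro mult_right_mono) auto
      then show "p ^ card (\<Union>T) \<le> 2 * p ^ v * real (d T)" using T(3) by (simp add: algebra_simps)
    qed
    also have "\<dots> = 2 * p ^ v * real (\<Sum>T\<in>Sat. d T)" by (simp add: sum_distrib_left)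
    also have "(\<Sum>T\<in>Sat. d T) = (\<Sum>T\<in>Sat. \<Sum>Q\<in>\<H>. if T \<subseteq> Q then 1 else 0)"
      using fin\<H> by (simp add: d_def sum.If_cases Int_def)
    also have "\<dots> = (\<Sum>Q\<in>\<H>. \<Sum>T\<in>Sat. if T \<subseteq> Q then 1 else 0)" by (rule sum.swap)
    also have "\<dots> \<le> (\<Sum>Q\<in>\<H>. 2 ^ r)"
    proof (rule sum_mono)
      fix Q assume "Q \<in> \<H>"
      then have q: "Q \<subseteq> E" "card Q = r" using \<H>(1) Q by auto
      have "(\<Sum>T\<in>Sat. if T \<subseteq> Q then 1 else 0) = card (Sat \<inter> {T. T \<subseteq> Q})"
        using finSat by (simp add: sum.If_cases)
      also have "\<dots> \<le> card (Pow Q)"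
        using q finE by (intro card_mono) (auto intro: finite_subset)
      also have "\<dots> = 2 ^ r" using q finE by (simp add: card_Pow finite_subset)
      finally show "(\<Sum>T\<in>Sat. if T \<subseteq> Q then 1 else 0) \<le> (2::nat) ^ r" by simp
    qed
    finally have "(\<Sum>T\<in>Sat. p ^ card (\<Union>T)) \<le> 2 ^ (r + 1) * (real (card \<H>) * p ^ v)"
      using p0 by (simp add: algebra_simps)
    then have satsum: "4 * (\<Sum>T\<in>Sat. p ^ card (\<Union>T)) < p\<^sup>2 * real (card E)"
      using few by (simp add: power_add)
    \<comment> \<open>\<open>x R\<close> is a lower bound for the edges left in \<open>R\<close>
      after one deletion per saturated set. On average the edges give at least
      \<open>p\<^sup>2 * card E / 2\<close> and the deletions cost at most half of that.\<close>
    define x where "x R = real (card {e\<in>E. e \<subseteq> R}) - real (card {T\<in>Sat. \<Union>T \<subseteq> R})" for R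
    have "(\<Sum>R\<in>\<R>. real (card {e\<in>E. e \<subseteq> R})) = (\<Sum>R\<in>\<R>. \<Sum>e\<in>E. if e \<subseteq> R then 1 else 0)"
      using finE by (simp add: sum.If_cases Int_def)
    also have "\<dots> = (\<Sum>e\<in>E. \<Sum>R\<in>\<R>. if e \<subseteq> R then 1 else 0)" by (rule sum.swap)
    also have "\<dots> = (\<Sum>e\<in>E. real (card {R. R \<subseteq> V \<and> card R = m \<and> e \<subseteq> R}))"
      using finR by (simp add: sum.If_cases Int_def \<R>_def conj_assoc)
    also have "\<dots> \<ge> (\<Sum>e\<in>E. real (card \<R>) * p\<^sup>2 / 2)"
      unfolding cardR p using E V m by (intro sum_mono card_supersets_pair_ge) auto
    finally have 1: "(\<Sum>R\<in>\<R>. real (card {e\<in>E. e \<subseteq> R})) \<ge> real (card E) * (real (card \<R>) * p\<^sup>2 / 2)"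
      by simp
    have "(\<Sum>R\<in>\<R>. real (card {T\<in>Sat. \<Union>T \<subseteq> R})) = (\<Sum>R\<in>\<R>. \<Sum>T\<in>Sat. if \<Union>T \<subseteq> R then 1 else 0)"
      using finSat by (simp add: sum.If_cases Int_def)
    also have "\<dots> = (\<Sum>T\<in>Sat. \<Sum>R\<in>\<R>. if \<Union>T \<subseteq> R then 1 else 0)" by (rule sum.swap)
    also have "\<dots> = (\<Sum>T\<in>Sat. real (card {R. R \<subseteq> V \<and> card R = m \<and> \<Union>T \<subseteq> R}))"
      using finR by (simp add: sum.If_cases Int_def \<R>_def conj_assoc)
    also have "\<dots> \<le> (\<Sum>T\<in>Sat. real (card \<R>) * p ^ card (\<Union>T))"
      unfolding cardR p using V m UV SatE by (intro sum_mono card_supersets_le) auto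
    also have "\<dots> = real (card \<R>) * (\<Sum>T\<in>Sat. p ^ card (\<Union>T))" by (simp add: sum_distrib_left)
    also have "\<dots> \<le> real (card \<R>) * (p\<^sup>2 * real (card E) / 4)"
      using satsum by (intro mult_left_mono) auto
    finally have "(\<Sum>R\<in>\<R>. x R) \<ge> real (card \<R>) * (p\<^sup>2 * real (card E) / 4)"
      using 1 by (simp add: x_def sum_subtractf algebra_simps)
    then obtain R where R: "R \<in> \<R>" "x R \<ge> p\<^sup>2 * real (card E) / 4"
    proof -
      have "\<exists>R\<in>\<R>. x R \<ge> p\<^sup>2 * real (card E) / 4"
      proof (rule ccontr)
        assume "\<not> ?thesis"
        then have "(\<Sum>R\<in>\<R>. x R) < (\<Sum>R\<in>\<R>. p\<^sup>2 * real (card E) / 4)"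
          using cardR0 finR by (intro sum_strict_mono) (auto simp: not_le card_gt_0_iff)
        then show False using \<open>(\<Sum>R\<in>\<R>. x R) \<ge> _\<close> by simp
      qed
      then show ?thesis using that by blast
    qed
    define SR where "SR = {T\<in>Sat. \<Union>T \<subseteq> R}"
    define h where "h T = (SOME e. e \<in> T)" for T :: "'v set set"
    have h: "h T \<in> T" if "T \<in> Sat" for T
      using that unfolding h_def Sat_def by (auto intro: someI_ex)
    define E' where "E' = {e\<in>E. e \<subseteq> R} - h ` SR"
    have "card {e\<in>E. e \<subseteq> R} - card (h ` SR) \<le> card E'"
      unfolding E'_def using finSat by (intro diff_card_le_card_Diff) (auto simp: SR_def)
    moreover have "card (h ` SR) \<le> card SR" using finSat by (intro card_image_le) (auto simp: SR_def)
    ultimately have "x R \<le> real (card E')" unfolding x_def SR_def by linarith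
    then have "real (card E') > g" using R g by linarith
    moreover have "R \<subseteq> V" "card R = m" "E' \<subseteq> E" "\<forall>e\<in>E'. e \<subseteq> R"
      using R(1) by (auto simp: \<R>_def E'_def)
    ultimately obtain Q0 where Q0: "Q0 \<in> \<Q>" "Q0 \<subseteq> E'" using dense by metis
    \<comment> \<open>Every saturated set spanned by \<open>R\<close> has lost an edge in
      \<open>E'\<close>, so the copy found there contains none. Adding it keeps the family spread,
      against maximality.\<close>
    have unsat: "T \<notin> Sat" if "T \<subseteq> Q0" for T
    proof
      assume T: "T \<in> Sat"
      have "\<Union>T \<subseteq> R" using that Q0 unfolding E'_def by blast
      then have "h T \<in> h ` SR" using T by (simp add: SR_def)
      then show False using h[OF T] that Q0 by (auto simp: E'_def)
    qed
    have Q0p: "Q0 \<noteq> {}" "card (\<Union>Q0) = v" using Q[OF Q0(1)] r by auto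
    have "Q0 \<notin> \<H>"
    proof
      assume "Q0 \<in> \<H>"
      then have "d Q0 > 0" using fin\<H> by (auto simp: d_def card_gt_0_iff)
      then have "(real (d Q0) + 1) * p ^ v > 1 * p ^ v"
        using p0 by (intro mult_strict_right_mono) auto
      then have "Q0 \<in> Sat" using Q0p \<open>Q0 \<in> \<H>\<close> by (auto simp: Sat_def)
      then show False using unsat by blast
    qed
    have "spread p v (insert Q0 \<H>)"
      unfolding spread_def
    proof (intro allI impI)
      fix T assume T: "T \<noteq> {}" "\<exists>Q\<in>insert Q0 \<H>. T \<subseteq> Q"
      show "real (card {Q\<in>insert Q0 \<H>. T \<subseteq> Q}) * p ^ v \<le> p ^ card (\<Union>T)"
      proof (cases "T \<subseteq> Q0")
        case True
        then have "{Q\<in>insert Q0 \<H>. T \<subseteq> Q} = insert Q0 {Q\<in>\<H>. T \<subseteq> Q}" by auto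
        then have c: "card {Q\<in>insert Q0 \<H>. T \<subseteq> Q} = Suc (d T)"
          using \<open>Q0 \<notin> \<H>\<close> fin\<H> by (simp add: d_def)
        show ?thesis
        proof (cases "\<exists>Q\<in>\<H>. T \<subseteq> Q")
          case Te: True
          then have "(real (d T) + 1) * p ^ v \<le> p ^ card (\<Union>T)"
            using unsat[OF True] T(1) unfolding Sat_def by (simp add: not_less)
          then show ?thesis unfolding c by (simp add: add.commute)
        next
          case False
          \<comment> \<open>Now \<open>T\<close> has degree 1 in the enlarged family, which
            \<open>spread\<close> allows because \<open>p \<le> 1\<close> and \<open>T\<close>
            covers at most \<open>v\<close> vertices.\<close>
          then have "{Q\<in>\<H>. T \<subseteq> Q} = {}" by auto
          then have "d T = 0" unfolding d_def by (metis card.empty)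
          moreover have "\<Union>Q0 \<subseteq> V" using UV Q[OF Q0(1)] by blast
          then have "card (\<Union>T) \<le> v" unfolding Q0p(2)[symmetric] using True V
            by (intro card_mono) (auto intro: finite_subset)
          then have "p ^ v \<le> p ^ card (\<Union>T)" using p0 p1 by (intro power_decreasing) auto
          ultimately show ?thesis unfolding c by simp
        qed
      next
        case False
        then have "{Q\<in>insert Q0 \<H>. T \<subseteq> Q} = {Q\<in>\<H>. T \<subseteq> Q}" by auto
        moreover have "\<exists>Q\<in>\<H>. T \<subseteq> Q" using T False by auto
        ultimately show ?thesis using \<H>(2) T(1) unfolding spread_def by simp
      qed
    qed
    then have "card (insert Q0 \<H>) \<le> card \<H>" using max[of "insert Q0 \<H>"] \<H>(1) Q0(1) by auto
    then show False using \<open>Q0 \<notin> \<H>\<close> fin\<H> by simp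
  qed
  then show ?thesis using \<H> by blast
qed

section \<open>The number of small subsets\<close>

lemma card_small_subsets_le:
  assumes V: "finite V" and x: "0 < x" "x \<le> 1" and k: "k \<ge> 0"
  shows "real (card (small_subsets V k)) \<le> exp (x * real (card V) - k * ln x)"
proof -
  \<comment> \<open>Exponential weighting: a set of size at most \<open>k\<close> has weight
    \<open>x ^ card S\<close> at least \<open>x powr k\<close>, while all subsets together weigh
    \<open>(1 + x) ^ card V\<close>.\<close>
  have "real (card (small_subsets V k)) * x powr k = (\<Sum>S\<in>small_subsets V k. x powr k)" by simp
  also have "\<dots> \<le> (\<Sum>S\<in>small_subsets V k. x ^ card S)"
    using x by (intro sum_mono) (auto simp: small_subsets_def powr_realpow[symmetric] intro: powr_mono')
  also have "\<dots> \<le> (\<Sum>S\<in>Pow V. x ^ card S)"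
    using V x by (intro sum_mono2) (auto simp: small_subsets_def)
  also have "\<dots> = (\<Prod>v\<in>V. x + 1)"
    using prod_add[OF V, of "\<lambda>_. x" "\<lambda>_. 1"] by simp
  also have "\<dots> = (1 + x) ^ card V" by (simp add: add.commute)
  also have "\<dots> \<le> exp x ^ card V" using x by (intro power_mono exp_ge_add_one_self) auto
  also have "\<dots> = exp (x * real (card V))" by (simp add: exp_of_nat_mult[symmetric] mult.commute)
  finally have "real (card (small_subsets V k)) * x powr k \<le> exp (x * real (card V))" .
  then show ?thesis using x by (simp add: powr_def exp_diff field_simps)
qed

text \<open>Taking \<open>x = \<tau>\<close> leaves a factor of order \<open>- ln \<tau>\<close>,
  absorbed here into a small power of \<open>\<tau>\<close>. The gap between
  \<open>1 / two_density H\<close> and \<open>b\<close> in \<open>container_step\<close> pays for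
  it.\<close>

lemma card_small_subsets_powr_le:
  assumes V: "finite V" and tau: "0 < \<tau>" "\<tau> \<le> 1" and A: "A > 0" and \<gamma>: "\<gamma> > 0"
  shows "real (card (small_subsets V (A * \<tau> * real (card V))))
    \<le> exp ((1 + A / \<gamma>) * \<tau> powr (1 - \<gamma>) * real (card V))"
proof -
  have "- ln \<tau> = ln (\<tau> powr (-\<gamma>)) / \<gamma>" using tau \<gamma> by (simp add: ln_powr)
  also have "ln (\<tau> powr (-\<gamma>)) \<le> \<tau> powr (-\<gamma>)" using ln_le_minus_one[of "\<tau> powr (-\<gamma>)"] tau by simp
  finally have l: "- ln \<tau> \<le> \<tau> powr (-\<gamma>) / \<gamma>" using \<gamma> by (simp add: divide_right_mono)
  have "1 \<le> \<tau> powr (-\<gamma>)" using powr_mono'[of "-\<gamma>" 0 \<tau>] tau \<gamma> by simp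
  moreover have "A * - ln \<tau> \<le> A * (\<tau> powr (-\<gamma>) / \<gamma>)" using l A by (intro mult_left_mono) auto
  ultimately have "1 - A * ln \<tau> \<le> (1 + A / \<gamma>) * \<tau> powr (-\<gamma>)" by (simp add: algebra_simps)
  then have "\<tau> * real (card V) * (1 - A * ln \<tau>) \<le> \<tau> * real (card V) * ((1 + A / \<gamma>) * \<tau> powr (-\<gamma>))"
    using tau by (intro mult_left_mono) auto
  also have "\<dots> = (1 + A / \<gamma>) * \<tau> powr (1 - \<gamma>) * real (card V)"
    using tau by (simp add: powr_diff powr_minus field_simps)
  finally have main: "\<tau> * real (card V) - A * \<tau> * real (card V) * ln \<tau>
      \<le> (1 + A / \<gamma>) * \<tau> powr (1 - \<gamma>) * real (card V)"
    by (simp add: algebra_simps)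
  have "0 \<le> A * \<tau> * real (card V)" using tau A by simp
  from card_small_subsets_le[OF V tau this]
  show ?thesis by (rule order_trans) (simp only: exp_le_cancel_iff main)
qed

section \<open>Copies, edge counts and the 2-density\<close>

lemma eventually_powr_gt:
  fixes c x B :: real
  assumes "c > 0" "x > 0"
  shows "eventually (\<lambda>n. c * real n powr x > B) sequentially"
proof -
  define Y where "Y = \<bar>B\<bar> / c + 1"
  have "c * Y = \<bar>B\<bar> + c" using assms by (simp add: Y_def field_simps)
  then have Y: "Y > 0" "c * Y > B" using assms by (auto simp: Y_def intro: add_nonneg_pos)
  show ?thesis unfolding eventually_sequentially
  proof (intro exI allI impI)
    fix n assume "nat \<lceil>Y powr (1 / x)\<rceil> \<le> n"
    then have "Y powr (1 / x) \<le> real n" by linarith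
    then have "(Y powr (1 / x)) powr x \<le> real n powr x" using assms by (intro powr_mono2) auto
    then have "Y \<le> real n powr x" using Y assms by (simp add: powr_powr)
    then have "c * Y \<le> c * real n powr x" using assms by (intro mult_left_mono) auto
    then show "c * real n powr x > B" using Y by linarith
  qed
qed

text \<open>The first \<open>n\<close> at which \<open>f n / n powr \<alpha>\<close> exceeds all its
  values up to \<open>Suc k\<close> is a record beyond \<open>k\<close>. It exists because the ratio
  grows at least like \<open>\<epsilon> * n powr \<beta>\<close>.\<close>

lemma infinite_ratio_records:
  fixes f :: "nat \<Rightarrow> real"
  assumes eps: "\<epsilon> > 0" "\<beta> > 0" and f: "\<And>n. n \<ge> 2 \<Longrightarrow> f n \<ge> \<epsilon> * real n powr (\<alpha> + \<beta>)"
  shows "infinite {n. n > 0 \<and> (\<forall>m\<in>{1..n}. f m * real n powr \<alpha> \<le> f n * real m powr \<alpha>)}"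
proof -
  let ?R = "{n. n > 0 \<and> (\<forall>m\<in>{1..n}. f m * real n powr \<alpha> \<le> f n * real m powr \<alpha>)}"
  have "\<exists>n>k. n \<in> ?R" for k
  proof -
  define g where "g n = f n / real n powr \<alpha>" for n
  define B where "B = Max (g ` {1..Suc k})"
  have B: "g m \<le> B" if "m \<in> {1..Suc k}" for m unfolding B_def using that by (intro Max_ge) auto
  have "eventually (\<lambda>n. \<epsilon> * real n powr \<beta> > B \<and> n \<ge> 2) sequentially"
    by (intro eventually_conj eventually_powr_gt eps eventually_ge_at_top)
  then obtain n where n: "\<epsilon> * real n powr \<beta> > B" "n \<ge> 2"
    using eventually_happens trivial_limit_sequentially by blast
  have "\<epsilon> * real n powr \<beta> \<le> g n"
    using f[OF n(2)] n(2) by (simp add: g_def powr_add field_simps)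
  then have "1 \<le> n \<and> g n > B" using n by simp
  then have ex: "\<exists>n. 1 \<le> n \<and> g n > B" by blast
  define n0 where "n0 = (LEAST n. 1 \<le> n \<and> g n > B)"
  have n0: "1 \<le> n0" "g n0 > B" using LeastI_ex[OF ex] by (auto simp: n0_def)
  have "n0 > k" using B[of n0] n0 by (cases "n0 > k") auto
  moreover have "f m * real n0 powr \<alpha> \<le> f n0 * real m powr \<alpha>" if m: "m \<in> {1..n0}" for m
  proof -
    have "g m \<le> g n0"
    proof (cases "m = n0")
      case False
      then have "\<not> (1 \<le> m \<and> g m > B)"
        using m not_less_Least[of m "\<lambda>n. 1 \<le> n \<and> g n > B"] by (auto simp: n0_def)
      then show ?thesis using m n0 by auto
    qed simp
    then show ?thesis using m by (simp add: g_def field_simps)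
  qed
  ultimately show ?thesis using n0 by (intro exI[of _ n0]) auto
  qed
  note unbounded = this
  show ?thesis
  proof
    assume "finite ?R"
    then obtain k where k: "\<forall>n\<in>?R. n < k" unfolding finite_nat_set_iff_bounded by blast
    obtain n where "n > k" "n \<in> ?R" using unbounded by blast
    with k have "n < k" by (elim bspec)
    with \<open>n > k\<close> show False by simp
  qed
qed

section \<open>Extremal numbers and copies as edge sets\<close>

lemma finite_pairs: "finite V \<Longrightarrow> finite {e. e \<subseteq> V \<and> card e = 2}"
  by (rule finite_subset[of _ "Pow V"]) auto

lemma card_pairs_le: "finite V \<Longrightarrow> card {e. e \<subseteq> V \<and> card e = 2} \<le> (card V)\<^sup>2"
  by (simp add: n_subsets choose_two power2_eq_square order_trans[OF div_le_dividend])

lemma card_edges_le: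
  assumes "fin_simple_graph G" shows "card (edges G) \<le> (card (verts G))\<^sup>2"
proof -
  have "card (edges G) \<le> card {e. e \<subseteq> verts G \<and> card e = 2}"
    using assms by (intro card_mono finite_pairs) (auto simp: fin_simple_graph_def)
  also have "\<dots> \<le> (card (verts G))\<^sup>2" using assms by (intro card_pairs_le) (simp add: fin_simple_graph_def)
  finally show ?thesis .
qed

lemma finite_edges:
  assumes "fin_simple_graph G" shows "finite (edges G)"
proof (rule finite_subset)
  show "edges G \<subseteq> {e. e \<subseteq> verts G \<and> card e = 2}" using assms by (simp add: fin_simple_graph_def)
  show "finite {e. e \<subseteq> verts G \<and> card e = 2}"
    using assms by (intro finite_pairs) (simp add: fin_simple_graph_def)
qed

lemma finite_free_edge_counts:
  "finite {card (edges G) |G :: nat graph.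
     fin_simple_graph G \<and> card (verts G) = n \<and> \<not> contains_copy G H}"
  by (rule finite_subset[of _ "{..n\<^sup>2}"]) (auto dest: card_edges_le)

lemma card_edges_le_ex_number:
  fixes G :: "nat graph"
  assumes "fin_simple_graph G" "card (verts G) = n" "\<not> contains_copy G H"
  shows "card (edges G) \<le> ex_number n H"
  unfolding ex_number_def using assms by (intro Max_ge finite_free_edge_counts) auto

text \<open>As \<open>H\<close> has an edge, the empty graph is \<open>H\<close>-free; the maximum
  is then over a nonempty set and is attained by a graph.\<close>

lemma ex_number_le:
  assumes "edges H \<noteq> {}" shows "ex_number n H \<le> n\<^sup>2"
proof -
  let ?S = "{card (edges G) |G :: nat graph.
     fin_simple_graph G \<and> card (verts G) = n \<and> \<not> contains_copy G H}"
  let ?G = "\<lparr>verts = {1..n}, edges = {}\<rparr> :: nat graph"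
  have "fin_simple_graph ?G \<and> card (verts ?G) = n \<and> \<not> contains_copy ?G H"
    using assms by (auto simp: fin_simple_graph_def contains_copy_def)
  then have "card (edges ?G) \<in> ?S" by blast
  then have "Max ?S \<in> ?S" using finite_free_edge_counts[of n H] by (intro Max_in) auto
  then obtain G :: "nat graph" where "Max ?S = card (edges G)" "fin_simple_graph G" "card (verts G) = n"
    by auto
  then show ?thesis unfolding ex_number_def using card_edges_le[of G] by simp
qed

definition free_edge_sets :: "'a graph \<Rightarrow> nat \<Rightarrow> nat set set \<Rightarrow> nat set set set" where
  "free_edge_sets H n E = {I. I \<subseteq> E \<and> \<not> contains_copy \<lparr>verts = {1..n}, edges = I\<rparr> H}"

text \<open>Copies are kept as edge sets, the hyperedges of the container argument, but the
  embedding must also place the isolated vertices of \<open>H\<close>, in agreement with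
  \<open>contains_copy\<close>.\<close>

definition copies :: "'a graph \<Rightarrow> nat \<Rightarrow> nat set set set" where
  "copies H n = {(\<lambda>e. f ` e) ` edges H |f. inj_on f (verts H) \<and> f ` verts H \<subseteq> {1..n}}"

lemma contains_copy_iff:
  "contains_copy \<lparr>verts = {1..n}, edges = I\<rparr> H \<longleftrightarrow> (\<exists>Q\<in>copies H n. Q \<subseteq> I)"
proof
  assume "contains_copy \<lparr>verts = {1..n}, edges = I\<rparr> H"
  then obtain f where "inj_on f (verts H)" "f ` verts H \<subseteq> {1..n}" "\<forall>e\<in>edges H. f ` e \<in> I"
    unfolding contains_copy_def by auto
  then show "\<exists>Q\<in>copies H n. Q \<subseteq> I"
    unfolding copies_def by (intro bexI[of _ "(\<lambda>e. f ` e) ` edges H"]) auto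
next
  assume "\<exists>Q\<in>copies H n. Q \<subseteq> I"
  then obtain f where "inj_on f (verts H)" "f ` verts H \<subseteq> {1..n}" "(\<lambda>e. f ` e) ` edges H \<subseteq> I"
    unfolding copies_def by blast
  then show "contains_copy \<lparr>verts = {1..n}, edges = I\<rparr> H"
    unfolding contains_copy_def by (intro exI[of _ f]) auto
qed

lemma card_free_graphs_le:
  "card (free_graphs n H) \<le> card (free_edge_sets H n {e. e \<subseteq> {1..n} \<and> card e = 2})"
proof -
  let ?P = "{e. e \<subseteq> {1..n::nat} \<and> card e = 2}"
  have "free_graphs n H \<subseteq> (\<lambda>I. \<lparr>verts = {1..n}, edges = I\<rparr>) ` free_edge_sets H n ?P"
  proof
    fix G assume G: "G \<in> free_graphs n H"
    obtain V I where VI: "G = \<lparr>verts = V, edges = I\<rparr>" by (cases G)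
    then have "V = {1..n}" "I \<in> free_edge_sets H n ?P"
      using G by (auto simp: free_graphs_def free_edge_sets_def fin_simple_graph_def simp del: One_nat_def)
    with VI show "G \<in> (\<lambda>I. \<lparr>verts = {1..n}, edges = I\<rparr>) ` free_edge_sets H n ?P" by blast
  qed
  moreover have fin: "finite (free_edge_sets H n ?P)"
    by (rule finite_subset[of _ "Pow ?P"]) (auto simp: free_edge_sets_def)
  ultimately have "card (free_graphs n H)
      \<le> card ((\<lambda>I. \<lparr>verts = {1..n}, edges = I\<rparr>) ` free_edge_sets H n ?P)"
    by (intro card_mono finite_imageI)
  also have "\<dots> \<le> card (free_edge_sets H n ?P)" by (rule card_image_le[OF fin])
  finally show ?thesis .
qed

text \<open>The edges in \<open>F\<close> with the vertices they cover form a subgraph that competes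
  in the maximum. Two distinct pairs cover at least three vertices, so its denominator is
  positive.\<close>

lemma two_density_ge:
  assumes H: "fin_simple_graph H" and F: "F \<subseteq> edges H" "card F \<ge> 2"
  shows "card (\<Union>F) > 2"
    and "real (card F) - 1 \<le> two_density H * (real (card (\<Union>F)) - 2)"
proof -
  have e: "e \<subseteq> verts H" "card e = 2" if "e \<in> edges H" for e
    using H that by (auto simp: fin_simple_graph_def)
  have UF: "\<Union>F \<subseteq> verts H" using F e by blast
  have "finite (verts H)" using H by (simp add: fin_simple_graph_def)
  with UF have finU: "finite (\<Union>F)" by (rule finite_subset)
  have "finite F" using F(2) by (intro card_ge_0_finite) simp
  then obtain x y where xy: "x \<in> F" "y \<in> F" "x \<noteq> y"
    using F(2) card_le_Suc0_iff_eq[of F] by auto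
  have "\<not> y \<subseteq> x"
  proof
    assume "y \<subseteq> x"
    moreover have c: "card x = 2" "card y = 2" using xy F e by auto
    moreover from c have "finite x" by (intro card_ge_0_finite) simp
    ultimately show False using card_subset_eq[of x y] xy(3) by simp
  qed
  then have "x \<subset> \<Union>F" using xy by auto
  then have "card x < card (\<Union>F)" by (rule psubset_card_mono[OF finU])
  then show big: "card (\<Union>F) > 2" using e xy F by auto
  let ?S = "{(real (card (edges F)) - 1) / (real (card (verts F)) - 2) |F.
            is_subgraph F H \<and> card (verts F) > 2}"
  have "?S \<subseteq> (\<lambda>(V, E). (real (card E) - 1) / (real (card V) - 2)) ` (Pow (verts H) \<times> Pow (edges H))"
    by (auto simp: is_subgraph_def image_iff)
  moreover have "finite (Pow (verts H) \<times> Pow (edges H))"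
    using H finite_edges[OF H] by (simp add: fin_simple_graph_def)
  ultimately have "finite ?S" by (rule finite_subset[OF _ finite_imageI])
  moreover have "is_subgraph \<lparr>verts = \<Union>F, edges = F\<rparr> H"
    using UF finU e F(1) unfolding is_subgraph_def fin_simple_graph_def by auto
  then have "(real (card F) - 1) / (real (card (\<Union>F)) - 2) \<in> ?S"
    using big by (intro CollectI exI[of _ "\<lparr>verts = \<Union>F, edges = F\<rparr>"]) auto
  ultimately have "(real (card F) - 1) / (real (card (\<Union>F)) - 2) \<le> two_density H"
    unfolding two_density_def by (rule Max_ge)
  then show "real (card F) - 1 \<le> two_density H * (real (card (\<Union>F)) - 2)"
    using big by (simp add: divide_le_eq)
qed

lemma copies_props:
  assumes H: "fin_simple_graph H" and Q: "Q \<in> copies H n"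
  shows "Q \<subseteq> {e. e \<subseteq> {1..n} \<and> card e = 2}" and "card Q = card (edges H)"
    and "card (\<Union>Q) = card (\<Union>(edges H))"
    and "T \<subseteq> Q \<Longrightarrow> \<exists>F\<subseteq>edges H. card F = card T \<and> card (\<Union>F) = card (\<Union>T)"
proof -
  obtain f where f: "inj_on f (verts H)" "f ` verts H \<subseteq> {1..n}" "Q = (\<lambda>e. f ` e) ` edges H"
    using Q by (auto simp: copies_def)
  have e: "e \<subseteq> verts H" "card e = 2" if "e \<in> edges H" for e
    using H that by (auto simp: fin_simple_graph_def)
  show "Q \<subseteq> {e. e \<subseteq> {1..n} \<and> card e = 2}"
    unfolding f(3)
  proof (rule image_subsetI)
    fix x assume x: "x \<in> edges H"
    have "f ` x \<subseteq> {1..n}" using image_mono[OF e(1)[OF x], of f] f(2) by (rule order_trans)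
    moreover have "card (f ` x) = 2"
      using card_image[OF inj_on_subset[OF f(1) e(1)[OF x]]] e(2)[OF x] by simp
    ultimately show "f ` x \<in> {e. e \<subseteq> {1..n} \<and> card e = 2}" by blast
  qed
  have inj: "inj_on (\<lambda>e. f ` e) (edges H)"
  proof (rule inj_onI)
    fix x y assume "x \<in> edges H" "y \<in> edges H" "f ` x = f ` y"
    then show "x = y" using inj_on_image_eq_iff[OF f(1), of x y] e by simp
  qed
  have U: "card (\<Union>((\<lambda>e. f ` e) ` F)) = card (\<Union>F)" if "F \<subseteq> edges H" for F
  proof -
    have "\<Union>F \<subseteq> verts H" using that e by blast
    then have "card (f ` \<Union>F) = card (\<Union>F)" by (rule card_image[OF inj_on_subset[OF f(1)]])
    then show ?thesis by (simp only: image_Union)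
  qed
  show "card Q = card (edges H)" using f inj by (simp add: card_image)
  show "card (\<Union>Q) = card (\<Union>(edges H))" using U f by simp
  assume "T \<subseteq> Q"
  then obtain F where F: "F \<subseteq> edges H" "T = (\<lambda>e. f ` e) ` F"
    unfolding f(3) by (auto simp: subset_image_iff)
  then have "card T = card F" by (simp add: card_image[OF inj_on_subset[OF inj F(1)]])
  moreover have "card (\<Union>T) = card (\<Union>F)" unfolding F(2) by (rule U[OF F(1)])
  ultimately show "\<exists>F\<subseteq>edges H. card F = card T \<and> card (\<Union>F) = card (\<Union>T)"
    using F(1) by (intro exI[of _ F] conjI) simp_all
qed

lemma two_density_pos:
  assumes H: "fin_simple_graph H" and e: "card (edges H) \<ge> 2" shows "two_density H > 0"
proof -
  have "1 \<le> two_density H * (real (card (\<Union>(edges H))) - 2)" "card (\<Union>(edges H)) > 2"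
    using two_density_ge[OF H order_refl e] e by auto
  then have "\<not> two_density H \<le> 0"
    using mult_nonpos_nonneg[of "two_density H" "real (card (\<Union>(edges H))) - 2"] by auto
  then show ?thesis by simp
qed

text \<open>For \<open>card T \<ge> 2\<close> this is \<open>two_density_ge\<close> pulled back to
  \<open>H\<close>; for a single edge both sides vanish.\<close>

lemma copy_density:
  assumes H: "fin_simple_graph H" and e: "card (edges H) \<ge> 2"
    and Q: "Q \<in> copies H n" and T: "T \<subseteq> Q" "T \<noteq> {}"
  shows "(real (card T) - 1) / two_density H \<le> real (card (\<Union>T)) - 2"
    and "card T \<ge> 1"
proof -
  obtain F where F: "F \<subseteq> edges H" "card F = card T" "card (\<Union>F) = card (\<Union>T)"
    using copies_props(4)[OF H Q T(1)] by blast
  have sub: "T \<subseteq> {e. e \<subseteq> {1..n} \<and> card e = 2}" using copies_props(1)[OF H Q] T by blast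
  then have "finite T" using finite_pairs[of "{1..n}"] finite_subset by blast
  then show T1: "card T \<ge> 1" using T by (simp add: Suc_leI card_gt_0_iff)
  show "(real (card T) - 1) / two_density H \<le> real (card (\<Union>T)) - 2"
  proof (cases "card T \<ge> 2")
    case True
    then show ?thesis using two_density_ge[OF H F(1)] F two_density_pos[OF H e]
      by (simp add: divide_le_eq mult.commute)
  next
    case False
    then have "card T = 1" using T1 by simp
    then obtain x where "T = {x}" by (auto simp: card_1_singleton_iff)
    then show ?thesis using sub by auto
  qed
qed

text \<open>This is the degree condition of \<open>container_bound\<close> with
  \<open>D = p\<^sup>2 / p ^ v\<close> and \<open>\<tau> = p powr (1 / two_density H)\<close>:
  \<open>spread\<close> bounds the degree by \<open>p ^ card (\<Union>T) / p ^ v\<close>, and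
  \<open>copy_density\<close> bounds the exponent from below.\<close>

lemma spread_wdeg_le:
  assumes H: "fin_simple_graph H" and e: "card (edges H) \<ge> 2"
    and sub: "\<H> \<subseteq> copies H n" "\<And>Q. Q \<in> \<H> \<Longrightarrow> Q \<subseteq> E" and fin: "finite E"
    and spread: "spread p v \<H>" and p: "0 < p" "p \<le> 1" and T: "T \<noteq> {}"
  shows "wdeg E (\<lambda>Z. if Z \<in> \<H> then 1 else 0) T
    \<le> p\<^sup>2 / p ^ v * (p powr (1 / two_density H)) ^ (card T - 1)"
proof -
  have "wdeg E (\<lambda>Z. if Z \<in> \<H> then 1 else 0) T = (\<Sum>Z | Z \<subseteq> E \<and> T \<subseteq> Z \<and> Z \<in> \<H>. 1)"
    unfolding wdeg_def using fin by (intro sum.mono_neutral_cong_right) auto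
  also have "{Z. Z \<subseteq> E \<and> T \<subseteq> Z \<and> Z \<in> \<H>} = {Q\<in>\<H>. T \<subseteq> Q}" using sub by auto
  finally have deg: "wdeg E (\<lambda>Z. if Z \<in> \<H> then 1 else 0) T = real (card {Q\<in>\<H>. T \<subseteq> Q})" by simp
  show ?thesis
  proof (cases "\<exists>Q\<in>\<H>. T \<subseteq> Q")
    case True
    then obtain Q where Q: "Q \<in> \<H>" "T \<subseteq> Q" by blast
    then have "Q \<in> copies H n" using sub by blast
    note cd = copy_density[OF H e this Q(2) T]
    have "real (card {Q\<in>\<H>. T \<subseteq> Q}) * p ^ v \<le> p ^ card (\<Union>T)"
      using spread True T unfolding spread_def by blast
    also have "\<dots> = p powr (2 + (real (card (\<Union>T)) - 2))" using p by (simp add: powr_realpow)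
    also have "\<dots> = p powr 2 * p powr (real (card (\<Union>T)) - 2)" by (rule powr_add)
    also have "\<dots> \<le> p powr 2 * p powr ((real (card T) - 1) / two_density H)"
      using p cd by (intro mult_left_mono powr_mono') auto
    also have "(real (card T) - 1) / two_density H = 1 / two_density H * real (card T - 1)"
      using cd(2) by simp
    also have "p powr \<dots> = (p powr (1 / two_density H)) ^ (card T - 1)"
      using p by (simp only: powr_powr[symmetric] powr_realpow powr_gt_zero)
    finally have "real (card {Q\<in>\<H>. T \<subseteq> Q}) * p ^ v
        \<le> p powr 2 * (p powr (1 / two_density H)) ^ (card T - 1)" .
    then have "real (card {Q\<in>\<H>. T \<subseteq> Q})
        \<le> p powr 2 * (p powr (1 / two_density H)) ^ (card T - 1) / p ^ v"
      using p by (simp only: pos_le_divide_eq zero_less_power)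
    then show ?thesis unfolding deg using p by simp
  next
    case False
    then have "{Q\<in>\<H>. T \<subseteq> Q} = {}" by auto
    then have "card {Q\<in>\<H>. T \<subseteq> Q} = 0" by (simp only: card.empty)
    then show ?thesis unfolding deg using p by simp
  qed
qed

section \<open>The container step and its iteration\<close>

text \<open>\<open>p0\<close> solves \<open>K * p0 powr b = 16\<close>. The bound on
  \<open>K\<close> gives \<open>p0 \<le> 1/2\<close> and \<open>large\<close> gives
  \<open>p0 * n \<ge> 2\<close>, so rounding \<open>p0 * n\<close> up at most doubles it and stays
  within \<open>n\<close>.\<close>

lemma sampling_size_exists:
  assumes b: "b > 0" and K: "K \<ge> 16 * 2 powr b" and n: "n \<ge> 1"
    and large: "16 * real n powr b \<ge> 2 powr b * K"
  shows "\<exists>m. 2 \<le> m \<and> m \<le> n \<and> 16 \<le> K * (real m / real n) powr b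
    \<and> K * (real m / real n) powr b \<le> 16 * 2 powr b"
proof -
  have K0: "K > 0" using K less_le_trans[of 0 "16 * 2 powr b" K] by simp
  define p0 where "p0 = (16 / K) powr (1 / b)"
  have p0: "p0 > 0" using K0 by (simp add: p0_def)
  have p0b: "p0 powr b = 16 / K" using b K0 by (simp add: p0_def powr_powr)
  have half: "p0 \<le> 1 / 2"
  proof (rule ccontr)
    assume "\<not> p0 \<le> 1 / 2"
    then have "(1 / 2) powr b < p0 powr b" using b by (intro powr_less_mono2) auto
    then have "K < 16 * 2 powr b" using K0 unfolding p0b by (simp add: powr_divide field_simps)
    then show False using K by simp
  qed
  have two: "p0 * real n \<ge> 2"
  proof (rule ccontr)
    assume "\<not> p0 * real n \<ge> 2"
    then have "(p0 * real n) powr b < 2 powr b" using b p0 n by (intro powr_less_mono2) auto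
    then have "16 * real n powr b < 2 powr b * K"
      using K0 p0 by (simp add: powr_mult p0b field_simps)
    then show False using large by simp
  qed
  define m where "m = nat \<lceil>p0 * real n\<rceil>"
  have m: "p0 * real n \<le> real m" "real m \<le> 2 * (p0 * real n)" using two unfolding m_def by linarith+
  have "p0 * real n \<le> 1 / 2 * real n" using half by (intro mult_right_mono) auto
  then have m2: "2 \<le> m" "m \<le> n" using m two by linarith+
  have p: "p0 \<le> real m / real n" "real m / real n \<le> 2 * p0" using m n by (simp_all add: field_simps)
  have "p0 powr b \<le> (real m / real n) powr b" "(real m / real n) powr b \<le> (2 * p0) powr b"
    using p p0 b by (intro powr_mono2; simp)+
  moreover have "(2 * p0) powr b = 2 powr b * (16 / K)" using p0 by (simp add: powr_mult p0b)
  ultimately have "16 / K \<le> (real m / real n) powr b" "(real m / real n) powr b \<le> 16 * 2 powr b / K"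
    unfolding p0b by (simp_all add: mult.commute)
  then have "16 \<le> K * (real m / real n) powr b" "K * (real m / real n) powr b \<le> 16 * 2 powr b"
    using K0 by (simp_all only: pos_divide_le_eq pos_le_divide_eq mult.commute)
  then show ?thesis using m2 by (intro exI[of _ m]) simp
qed

text \<open>More than \<open>ex_number m H\<close> edges on \<open>m\<close> vertices force a copy,
  so this number serves as the threshold \<open>g\<close> in
  \<open>balanced_supersaturation\<close>.\<close>

lemma spread_copies_exist:
  fixes H :: "'a graph"
  assumes H: "fin_simple_graph H" and e: "card (edges H) \<ge> 2"
    and E: "E \<subseteq> {e. e \<subseteq> {1..n} \<and> card e = 2}" and m: "2 \<le> m" "m \<le> n"
    and ex: "4 * real (ex_number m H) < (real m / real n)\<^sup>2 * real (card E)"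
  shows "\<exists>\<H>\<subseteq>copies H n. (\<forall>Q\<in>\<H>. Q \<subseteq> E) \<and> spread (real m / real n) (card (\<Union>(edges H))) \<H> \<and>
    real (card \<H>) * (real m / real n) ^ card (\<Union>(edges H))
      \<ge> (real m / real n)\<^sup>2 * real (card E) / 2 ^ (card (edges H) + 3)"
proof -
  let ?Q = "{Q\<in>copies H n. Q \<subseteq> E}"
  have "\<exists>\<H>\<subseteq>?Q. spread (real m / real n) (card (\<Union>(edges H))) \<H> \<and>
    real (card \<H>) * (real m / real n) ^ card (\<Union>(edges H))
      \<ge> (real m / real n)\<^sup>2 * real (card E) / 2 ^ (card (edges H) + 3)"
  proof (rule balanced_supersaturation[where V = "{1..n}" and g = "real (ex_number m H)"])
    show "Q \<subseteq> E \<and> card Q = card (edges H) \<and> card (\<Union>Q) = card (\<Union>(edges H))" if "Q \<in> ?Q" for Q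
      using that copies_props(2,3)[OF H, of Q n] by auto
    fix R E' assume R: "R \<subseteq> {1..n}" "card R = m" and E': "E' \<subseteq> E" "\<forall>e\<in>E'. e \<subseteq> R"
      and big: "real (card E') > real (ex_number m H)"
    have "fin_simple_graph \<lparr>verts = R, edges = E'\<rparr>"
      using R E E' by (auto simp: fin_simple_graph_def intro: finite_subset)
    then have "contains_copy \<lparr>verts = R, edges = E'\<rparr> H"
      using card_edges_le_ex_number[of "\<lparr>verts = R, edges = E'\<rparr>" m H] R big by force
    then have "contains_copy \<lparr>verts = {1..n}, edges = E'\<rparr> H"
      using R(1) unfolding contains_copy_def by (auto simp del: One_nat_def intro: order_trans)
    then obtain Q where "Q \<in> copies H n" "Q \<subseteq> E'" unfolding contains_copy_iff by blast
    then show "\<exists>Q\<in>?Q. Q \<subseteq> E'" using E'(1) by blast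
  qed (use m E ex e in auto)
  then obtain \<H> where "\<H> \<subseteq> ?Q" "spread (real m / real n) (card (\<Union>(edges H))) \<H>"
    "real (card \<H>) * (real m / real n) ^ card (\<Union>(edges H))
      \<ge> (real m / real n)\<^sup>2 * real (card E) / 2 ^ (card (edges H) + 3)" by blast
  then show ?thesis by (intro exI[of _ \<H>]) blast
qed

text \<open>The record condition carries the extremal number from \<open>n\<close> down to
  \<open>m\<close>; the comparison with \<open>n\<^sup>2\<close> keeps sampling possible up to the
  complete graph. The decay of the cost in \<open>K\<close> is what makes the iterated sum
  converge.\<close>

lemma container_step:
  fixes H :: "'a graph" and \<epsilon> b :: real
  assumes H: "fin_simple_graph H" and e: "card (edges H) \<ge> 2" and eps: "\<epsilon> > 0"
    and b: "b > 0" "1 / two_density H = b + \<epsilon> / 2"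
  shows "\<exists>\<delta> C. 0 < \<delta> \<and> \<delta> < 1 \<and> C \<ge> 0 \<and>
    (\<forall>n E M K. n \<ge> 1 \<longrightarrow> E \<subseteq> {e. e \<subseteq> {1..n} \<and> card e = 2} \<longrightarrow> ex_number n H > 0 \<longrightarrow>
      (\<forall>m\<in>{1..n}. real (ex_number m H) * real n powr (2 - b)
          \<le> real (ex_number n H) * real m powr (2 - b)) \<longrightarrow>
      2 powr b * (real n)\<^sup>2 \<le> 16 * real (ex_number n H) * real n powr b \<longrightarrow>
      K = real (card E) / real (ex_number n H) \<longrightarrow> K \<ge> 16 * 2 powr b \<longrightarrow>
      (\<forall>E'\<subseteq>E. real (card E') \<le> (1 - \<delta>) * real (card E) \<longrightarrow> card (free_edge_sets H n E') \<le> M) \<longrightarrow>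
      real (card (free_edge_sets H n E))
        \<le> exp (C * real (ex_number n H) * K powr (- (\<epsilon> / (4 * b)))) * real M)"
proof -
  define r where "r = card (edges H)"
  define v where "v = card (\<Union>(edges H))"
  define a where "a = 1 / two_density H"
  \<comment> \<open>\<open>\<gamma>\<close> and \<open>\<eta>\<close> halve the gap
    \<open>\<epsilon> / 2\<close> between \<open>a\<close> and \<open>b\<close>: both
    \<open>a * (1 - \<gamma>)\<close> and \<open>b * (1 + \<eta>)\<close> equal
    \<open>b + \<epsilon> / 4\<close>.\<close>
  define \<gamma> where "\<gamma> = \<epsilon> / (4 * a)"
  define \<eta> where "\<eta> = \<epsilon> / (4 * b)"
  define C1 where "C1 = 16 * 2 powr b"
  have a: "a > 0" "a = b + \<epsilon> / 2" using b eps by (auto simp: a_def)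
  have "a * \<gamma> = \<epsilon> / 4" using a(1) by (simp add: \<gamma>_def)
  then have gam: "\<gamma> > 0" "a * (1 - \<gamma>) = b + \<epsilon> / 4"
    using a eps by (simp_all add: \<gamma>_def right_diff_distrib)
  have r: "r > 0" using e by (simp add: r_def)
  have C1: "C1 > 0" by (simp add: C1_def)
  obtain \<delta> A where \<delta>: "0 < \<delta>" "\<delta> < 1" and A: "A > 0"
    and cont: "container_bound TYPE(nat set) r (1 / 2 ^ (r + 3)) \<delta> A"
    using container_bound_exists[OF r, of "1 / 2 ^ (r + 3)"] by auto
  define C where "C = real r * (1 + A / \<gamma>) * C1 powr (1 + \<eta>)"
  have C: "C \<ge> 0" using A gam by (simp add: C_def)
  have "real (card (free_edge_sets H n E))
        \<le> exp (C * real (ex_number n H) * K powr (- \<eta>)) * real M"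
    if n: "n \<ge> 1" and E: "E \<subseteq> {e. e \<subseteq> {1..n} \<and> card e = 2}" and f0: "ex_number n H > 0"
      and rec: "\<forall>m\<in>{1..n}. real (ex_number m H) * real n powr (2 - b)
          \<le> real (ex_number n H) * real m powr (2 - b)"
      and large: "2 powr b * (real n)\<^sup>2 \<le> 16 * real (ex_number n H) * real n powr b"
      and K: "K = real (card E) / real (ex_number n H)" and K16: "K \<ge> 16 * 2 powr b"
      and M: "\<forall>E'\<subseteq>E. real (card E') \<le> (1 - \<delta>) * real (card E) \<longrightarrow> card (free_edge_sets H n E') \<le> M"
    for n E M K
  proof -
    define f where "f = real (ex_number n H)"
    define N where "N = real (card E)"
    have f: "f > 0" using f0 by (simp add: f_def)
    have N: "N = K * f" using K f by (simp add: f_def N_def)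
    have K0: "K > 0" using K16 less_le_trans[of 0 "16 * 2 powr b" K] by simp
    have finE: "finite E" by (rule finite_subset[OF E finite_pairs]) simp
    have "card E \<le> n\<^sup>2"
      using card_mono[OF finite_pairs E] card_pairs_le[of "{1..n}"] by simp
    then have "N \<le> (real n)\<^sup>2" unfolding N_def by (metis of_nat_le_iff of_nat_power)
    then have "2 powr b * (K * f) \<le> 2 powr b * (real n)\<^sup>2" unfolding N by (intro mult_left_mono) auto
    also have "\<dots> \<le> 16 * f * real n powr b" using large by (simp add: f_def)
    finally have "(2 powr b * K) * f \<le> (16 * real n powr b) * f" by (simp add: ac_simps)
    then have "2 powr b * K \<le> 16 * real n powr b" using f by simp
    from sampling_size_exists[OF b(1) K16 n this] obtain m where
      m: "2 \<le> m" "m \<le> n" and pK: "16 \<le> K * (real m / real n) powr b"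
        "K * (real m / real n) powr b \<le> C1" unfolding C1_def by blast
    define p where "p = real m / real n"
    have p: "0 < p" "p \<le> 1" using m by (auto simp: p_def)
    \<comment> \<open>The record condition gives
      \<open>ex_number m H \<le> f * p powr (2 - b)\<close>. As
      \<open>K * p powr b \<ge> 16\<close>, the quantity \<open>p\<^sup>2 * N\<close> is at least 16
      times this, more than supersaturation asks.\<close>
    have "real (ex_number m H) * real n powr (2 - b) \<le> f * real m powr (2 - b)"
      using rec m by (simp add: f_def)
    then have "real (ex_number m H) \<le> f * p powr (2 - b)"
      using n m by (simp add: p_def powr_divide field_simps)
    moreover have "16 * (p powr (2 - b)) \<le> K * p powr b * p powr (2 - b)"
      using pK(1) by (intro mult_right_mono) (auto simp: p_def)
    then have "16 * p powr (2 - b) \<le> K * p\<^sup>2"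
      using p by (simp add: mult.assoc powr_add[symmetric])
    then have "16 * (f * p powr (2 - b)) \<le> p\<^sup>2 * N"
      using f unfolding N by (simp add: mult.left_commute mult.commute)
    moreover have "p\<^sup>2 * N > 0" using p K0 f by (simp add: N)
    ultimately have "4 * real (ex_number m H) < p\<^sup>2 * N" by linarith
    then obtain \<H> where \<H>: "\<H> \<subseteq> copies H n" "\<forall>Q\<in>\<H>. Q \<subseteq> E" and sp: "spread p v \<H>"
      and many: "real (card \<H>) * p ^ v \<ge> p\<^sup>2 * N / 2 ^ (r + 3)"
      using spread_copies_exist[OF H e E m] unfolding p_def N_def v_def r_def by blast
    define w where "w = (\<lambda>Z. if Z \<in> \<H> then 1 else 0 :: real)"
    define \<tau> where "\<tau> = p powr a"
    define J where "J = free_edge_sets H n E"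
    have tau: "0 < \<tau>" "\<tau> \<le> 1" using p a by (auto simp: \<tau>_def powr_le1)
    \<comment> \<open>\<open>\<I>\<close> and \<open>\<J>\<close> coincide here, since
      \<open>H\<close>-freeness is inherited by edge subsets. The density
      \<open>1 / 2 ^ (r + 3)\<close> is the one in \<open>many\<close>.\<close>
    have "card J \<le> card (small_subsets E (A * \<tau> * real (card E))) ^ r * M"
    proof (rule cont[unfolded container_bound_def, rule_format])
      show "finite E" by (rule finE)
      show "uniform_weight E r w"
        using \<H> copies_props(2)[OF H] unfolding uniform_weight_def w_def r_def by auto
      show "0 < p\<^sup>2 / p ^ v" using p by simp
      show "0 < \<tau>" by (rule tau)
      show "wdeg E w T \<le> p\<^sup>2 / p ^ v * \<tau> ^ (card T - 1)" if "T \<noteq> {}" "T \<subseteq> E" for T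
        unfolding w_def \<tau>_def a_def using \<H> that p sp finE
        by (intro spread_wdeg_le[OF H e]) auto
      have "sum w (Pow E) = (\<Sum>Z\<in>\<H>. 1)"
        unfolding w_def using \<H> finE by (intro sum.mono_neutral_cong_right) auto
      then show "1 / 2 ^ (r + 3) * (p\<^sup>2 / p ^ v) * real (card E) \<le> sum w (Pow E)"
        using many p by (simp add: N_def field_simps)
      show "J \<subseteq> J" "J \<subseteq> Pow E" by (auto simp: J_def free_edge_sets_def)
      show "I' \<in> J" if "I \<in> J" "I' \<subseteq> I" for I I'
        using that unfolding J_def free_edge_sets_def contains_copy_iff by blast
      show "\<not> Z \<subseteq> I" if "I \<in> J" "w Z \<noteq> 0" for I Z
        using that \<H> unfolding J_def free_edge_sets_def contains_copy_iff w_def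
        by (auto split: if_splits)
      show "card {I\<in>J. I \<subseteq> E'} \<le> M" if "E' \<subseteq> E" "real (card E') \<le> (1 - \<delta>) * real (card E)" for E'
      proof -
        have "{I\<in>J. I \<subseteq> E'} = free_edge_sets H n E'" using that by (auto simp: J_def free_edge_sets_def)
        then show ?thesis using M that by simp
      qed
    qed
    then have "real (card J) \<le> real (card (small_subsets E (A * \<tau> * N))) ^ r * real M"
      unfolding N_def by (metis of_nat_le_iff of_nat_mult of_nat_power)
    also have "\<dots> \<le> exp ((1 + A / \<gamma>) * \<tau> powr (1 - \<gamma>) * N) ^ r * real M"
      unfolding N_def using card_small_subsets_powr_le[OF finE tau A gam(1)]
      by (intro mult_right_mono power_mono) auto
    also have "\<dots> = exp (real r * (1 + A / \<gamma>) * (\<tau> powr (1 - \<gamma>) * N)) * real M"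
      by (simp add: exp_of_nat_mult[symmetric] ac_simps)
    also have "\<dots> \<le> exp (real r * (1 + A / \<gamma>) * (C1 powr (1 + \<eta>) * (f * K powr (- \<eta>)))) * real M"
    proof -
      \<comment> \<open>\<open>\<tau> powr (1 - \<gamma>)\<close> is \<open>p powr b\<close> raised
        to \<open>1 + \<eta>\<close>: one factor \<open>1 / K\<close> cancels the \<open>K\<close>
        in \<open>N = K * f\<close>, and \<open>K powr (- \<eta>)\<close> remains.\<close>
      have pb: "p powr b \<le> C1 / K" using pK(2) K0 by (simp add: p_def field_simps)
      have "\<tau> powr (1 - \<gamma>) = p powr (b + \<epsilon> / 4)" by (simp add: \<tau>_def powr_powr gam(2))
      also have "b + \<epsilon> / 4 = b * (1 + \<eta>)" using b(1) by (simp add: \<eta>_def distrib_left)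
      also have "p powr \<dots> = (p powr b) powr (1 + \<eta>)" by (simp add: powr_powr)
      also have "\<dots> \<le> (C1 / K) powr (1 + \<eta>)" using pb b eps by (intro powr_mono2) (auto simp: \<eta>_def)
      also have "\<dots> = C1 powr (1 + \<eta>) / K powr (1 + \<eta>)" using C1 K0 by (simp only: powr_divide)
      also have "K powr (1 + \<eta>) = K * K powr \<eta>" using K0 by (simp add: powr_add)
      also have "C1 powr (1 + \<eta>) / (K * K powr \<eta>) = C1 powr (1 + \<eta>) * (K powr (- \<eta>) / K)"
        using K0 by (simp add: powr_minus divide_inverse)
      finally have "\<tau> powr (1 - \<gamma>) * N \<le> C1 powr (1 + \<eta>) * (K powr (- \<eta>) / K) * (K * f)"
        unfolding N using K0 f by (intro mult_right_mono) auto
      also have "\<dots> = C1 powr (1 + \<eta>) * (f * K powr (- \<eta>))" using K0 by simp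
      finally have "\<tau> powr (1 - \<gamma>) * N \<le> C1 powr (1 + \<eta>) * (f * K powr (- \<eta>))" .
      moreover have "0 \<le> real r * (1 + A / \<gamma>)" using A gam by simp
      ultimately have "real r * (1 + A / \<gamma>) * (\<tau> powr (1 - \<gamma>) * N)
          \<le> real r * (1 + A / \<gamma>) * (C1 powr (1 + \<eta>) * (f * K powr (- \<eta>)))"
        by (rule mult_left_mono)
      then show ?thesis by (intro mult_right_mono) (simp_all only: exp_le_cancel_iff of_nat_0_le_iff)
    qed
    also have "\<dots> = exp (C * f * K powr (- \<eta>)) * real M" by (simp add: C_def ac_simps)
    finally show ?thesis by (simp add: J_def f_def)
  qed
  note step = this[unfolded \<eta>_def]
  show ?thesis
    by (intro exI[of _ \<delta>] exI[of _ C] conjI allI impI; (rule \<delta> C | (rule step; assumption)))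
qed

text \<open>Write \<open>K\<close> for \<open>card E / f\<close>. The exponent \<open>K1 + B * (1 - K powr - \<eta>)\<close> is increasing and
  bounded in \<open>K\<close>, and passing from \<open>(1 - \<delta>) K\<close> to \<open>K\<close> raises it by at least
  the cost \<open>C * K powr - \<eta>\<close> of one step.\<close>

lemma iterated_container_bound:
  fixes cnt :: "'v set \<Rightarrow> nat" and f :: real
  assumes f: "f > 0" and \<delta>: "0 < \<delta>" "\<delta> < 1" and \<eta>: "\<eta> > 0" and C: "C \<ge> 0"
    and K1: "K1 \<ge> 1 / (1 - \<delta>)" and P: "finite P"
    and triv: "\<And>E. E \<subseteq> P \<Longrightarrow> cnt E \<le> 2 ^ card E"
    and step: "\<And>E M. E \<subseteq> P \<Longrightarrow> real (card E) / f \<ge> K1 \<Longrightarrow>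
        (\<And>E'. E' \<subseteq> E \<Longrightarrow> real (card E') \<le> (1 - \<delta>) * real (card E) \<Longrightarrow> cnt E' \<le> M) \<Longrightarrow>
        real (cnt E) \<le> exp (C * f * (real (card E) / f) powr (- \<eta>)) * real M"
  shows "real (cnt P) \<le> exp (f * (K1 + C / ((1 - \<delta>) powr (- \<eta>) - 1)))"
proof -
  define q where "q = (1 - \<delta>) powr (- \<eta>)"
  \<comment> \<open>Chosen so that \<open>B * q = B + C\<close>: the growth of the exponent then
    exactly pays for one step.\<close>
  define B where "B = C / (q - 1)"
  have "(1 - \<delta>) powr \<eta> < 1" using \<delta> \<eta> powr_less_mono2[of \<eta> "1 - \<delta>" 1] by simp
  then have q: "q > 1" unfolding q_def powr_minus using \<delta> by (simp add: one_less_inverse)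
  then have B: "B \<ge> 0" "B * q = B + C" using C by (auto simp: B_def field_simps)
  have K1': "(1 - \<delta>) * K1 \<ge> 1" "K1 \<ge> 1"
  proof -
    show 1: "(1 - \<delta>) * K1 \<ge> 1" using K1 \<delta> by (simp add: field_simps)
    have "1 \<le> 1 / (1 - \<delta>)" using \<delta> by simp
    then show "K1 \<ge> 1" using K1 by linarith
  qed
  define \<kappa> where "\<kappa> E = max 1 (real (card E) / f)" for E :: "'v set"
  have main: "real (cnt E) \<le> exp (f * (K1 + B * (1 - \<kappa> E powr (- \<eta>))))" if "E \<subseteq> P" for E
    using that
  proof (induction "card E" arbitrary: E rule: less_induct)
    case less
    have "\<kappa> E \<ge> 1" by (simp add: \<kappa>_def)
    then have "\<kappa> E powr (- \<eta>) \<le> 1" using \<eta> powr_mono[of "- \<eta>" 0 "\<kappa> E"] by simp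
    then have nonneg: "0 \<le> B * (1 - \<kappa> E powr (- \<eta>))"
      using B(1) by simp
    show ?case
    proof (cases "real (card E) / f \<ge> K1")
      case False
      have "real (cnt E) \<le> 2 ^ card E" using triv[OF less.prems] by (metis of_nat_le_iff of_nat_numeral of_nat_power)
      also have "\<dots> \<le> exp 1 ^ card E" using exp_ge_add_one_self[of 1] by (intro power_mono) auto
      also have "\<dots> = exp (real (card E))" by (simp add: exp_of_nat_mult[symmetric])
      also have "\<dots> \<le> exp (f * K1)" using False f by (simp add: field_simps)
      also have "\<dots> \<le> exp (f * (K1 + B * (1 - \<kappa> E powr (- \<eta>))))" using nonneg f by simp
      finally show ?thesis .
    next
      case True
      define k where "k = real (card E) / f"
      have k: "k \<ge> K1" "k \<ge> 1" "\<kappa> E = k" using True K1' by (auto simp: \<kappa>_def k_def)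
      have cE: "real (card E) > 0" using k f by (auto simp: k_def)
      define X where "X = exp (f * (K1 + B * (1 - q * k powr (- \<eta>))))"
      define M where "M = nat \<lfloor>X\<rfloor>"
      have "cnt E' \<le> M" if E': "E' \<subseteq> E" "real (card E') \<le> (1 - \<delta>) * real (card E)" for E'
      proof -
        have "(1 - \<delta>) * real (card E) < 1 * real (card E)"
          using \<delta> cE by (intro mult_strict_right_mono) auto
        then have "card E' < card E" using E'(2) by simp
        then have IH: "real (cnt E') \<le> exp (f * (K1 + B * (1 - \<kappa> E' powr (- \<eta>))))"
          using less.hyps[of E'] E'(1) less.prems by blast
        \<comment> \<open>Since \<open>(1 - \<delta>) * K1 \<ge> 1\<close>, the cut-off at 1 in
          \<open>\<kappa>\<close> does no harm: \<open>\<kappa> E'\<close> is still at most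
          \<open>(1 - \<delta>) * k\<close>.\<close>
        have "(1 - \<delta>) * K1 \<le> (1 - \<delta>) * k" using k \<delta> by (intro mult_left_mono) auto
        moreover have "real (card E') / f \<le> (1 - \<delta>) * k" using E'(2) f by (simp add: k_def divide_right_mono)
        ultimately have "\<kappa> E' \<le> (1 - \<delta>) * k" "\<kappa> E' \<ge> 1" using K1' by (auto simp: \<kappa>_def)
        then have "((1 - \<delta>) * k) powr (- \<eta>) \<le> \<kappa> E' powr (- \<eta>)"
          using \<eta> by (intro powr_mono2') auto
        then have "q * k powr (- \<eta>) \<le> \<kappa> E' powr (- \<eta>)"
          using k \<delta> by (simp add: powr_mult q_def)
        then have "f * (K1 + B * (1 - \<kappa> E' powr (- \<eta>))) \<le> f * (K1 + B * (1 - q * k powr (- \<eta>)))"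
          using f B(1) by (intro mult_left_mono add_left_mono) auto
        then have "real (cnt E') \<le> X" using IH unfolding X_def by (meson exp_le_cancel_iff order_trans)
        then show ?thesis unfolding M_def by (simp add: le_nat_floor)
      qed
      then have "real (cnt E) \<le> exp (C * f * k powr (- \<eta>)) * real M"
        using step[OF less.prems True, of M] by (simp add: k_def)
      also have "\<dots> \<le> exp (C * f * k powr (- \<eta>)) * X"
        unfolding M_def X_def by (intro mult_left_mono) (auto simp: of_nat_nat)
      also have "\<dots> = exp (C * f * k powr (- \<eta>) + f * (K1 + B * (1 - q * k powr (- \<eta>))))"
        by (simp add: X_def exp_add)
      also have "C * f * k powr (- \<eta>) + f * (K1 + B * (1 - q * k powr (- \<eta>)))
          = f * (K1 + B + k powr (- \<eta>) * (C - B * q))" by (simp add: algebra_simps)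
      also have "\<dots> = f * (K1 + B * (1 - \<kappa> E powr (- \<eta>)))" by (simp add: B(2) k(3) algebra_simps)
      finally show ?thesis .
    qed
  qed
  have "real (cnt P) \<le> exp (f * (K1 + B * (1 - \<kappa> P powr (- \<eta>))))" by (rule main) simp
  also have "\<dots> \<le> exp (f * (K1 + B))" using f B(1) by (simp add: algebra_simps)
  finally show ?thesis by (simp add: B_def q_def)
qed

text \<open>Once there is room for all vertices of \<open>H\<close>, any edge of \<open>G\<close>
  yields a copy: the edge of \<open>H\<close>, if any, goes onto it and the other vertices go
  anywhere else. Only the empty graph can be \<open>H\<close>-free.\<close>

lemma free_graphs_few_edges:
  assumes H: "fin_simple_graph H" and e: "card (edges H) \<le> 1" and n: "n \<ge> card (verts H)" "n \<ge> 1"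
  shows "card (free_graphs n H) \<le> 1"
proof -
  have finV: "finite (verts H)" using H by (simp add: fin_simple_graph_def)
  have "edges G = {}" if G: "G \<in> free_graphs n H" for G
  proof (rule ccontr)
    assume "edges G \<noteq> {}"
    then obtain g where g: "g \<in> edges G" by blast
    have G': "verts G = {1..n}" "fin_simple_graph G" "\<not> contains_copy G H"
      using G by (auto simp: free_graphs_def)
    then have g2: "g \<subseteq> {1..n}" "card g = 2" using g by (auto simp: fin_simple_graph_def)
    have fing: "finite g" using g2 by (intro card_ge_0_finite) simp
    \<comment> \<open>\<open>h\<close> is the edge of \<open>H\<close>, or empty if there is none;
      this treats both cases with one embedding.\<close>
    obtain h where h: "h \<subseteq> verts H" "card h \<le> 2" "\<And>x. x \<in> edges H \<Longrightarrow> x = h \<and> card h = 2"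
    proof (cases "edges H = {}")
      case True
      then show ?thesis using that[of "{}"] by simp
    next
      case False
      then obtain h where h: "h \<in> edges H" by blast
      then have "x = h" if "x \<in> edges H" for x
        using that e card_le_Suc0_iff_eq[OF finite_edges[OF H]] by auto
      moreover have "h \<subseteq> verts H" "card h = 2" using h H by (auto simp: fin_simple_graph_def)
      ultimately show ?thesis using that[of h] by auto
    qed
    have finh: "finite h" using h(1) finV by (rule finite_subset)
    obtain g' where g': "g' \<subseteq> g" "card g' = card h"
      using h(2) g2(2) by (metis obtain_subset_with_card_n)
    have fing': "finite g'" using g'(1) fing by (rule finite_subset)
    obtain f1 where f1: "bij_betw f1 h g'"
      using finite_same_card_bij[OF finh fing'] g'(2) by auto
    have "card (verts H - h) \<le> card ({1..n} - g')"
      using card_Diff_subset[OF finh h(1)] card_Diff_subset[OF fing', of "{1..n}"] g' g2 n by simp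
    then obtain f2 where f2: "inj_on f2 (verts H - h)" "f2 ` (verts H - h) \<subseteq> {1..n} - g'"
      using card_le_inj[of "verts H - h" "{1..n} - g'"] finV by auto
    define f where "f x = (if x \<in> h then f1 x else f2 x)" for x
    have fh: "f ` h = g'" using f1 by (simp add: f_def bij_betw_def)
    have fr: "f ` (verts H - h) = f2 ` (verts H - h)" by (auto simp: f_def)
    have "inj_on f h" using f1 by (simp add: f_def bij_betw_def inj_on_def)
    moreover have "inj_on f (verts H - h)" using f2(1) by (simp add: f_def inj_on_def)
    ultimately have "inj_on f (h \<union> (verts H - h))"
      unfolding inj_on_Un fh fr using fh fr f2(2) by blast
    moreover have "h \<union> (verts H - h) = verts H" using h(1) by blast
    moreover have "f ` verts H \<subseteq> {1..n}"
    proof -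
      have "f ` verts H = f ` h \<union> f ` (verts H - h)" using h(1) by blast
      then show ?thesis unfolding fh fr using f2(2) g'(1) g2(1) by blast
    qed
    moreover have "f ` x \<in> edges G" if "x \<in> edges H" for x
    proof -
      have "x = h" "card g' = card g" using h(3)[OF that] g' g2 by auto
      then have "f ` x = g" using fh card_subset_eq[OF fing g'(1)] by simp
      then show ?thesis using g by simp
    qed
    ultimately have "contains_copy G H" unfolding contains_copy_def G'(1) by auto
    then show False using G'(3) by simp
  qed
  then have "free_graphs n H \<subseteq> {\<lparr>verts = {1..n}, edges = {}\<rparr>}"
    by (auto simp: free_graphs_def)
  then show ?thesis using card_mono[of "{\<lparr>verts = {1..n}, edges = {}\<rparr>}"] by fastforce
qed

section \<open>Counting free graphs at the record values of \<open>n\<close>\<close>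

theorem theorem1p5:
  fixes H :: "'a graph" and \<epsilon> :: real
  assumes "fin_simple_graph H"
    and "\<epsilon> > 0"
    and "\<forall>n\<ge>2. real (ex_number n H) \<ge> \<epsilon> * real n powr (2 - 1 / two_density H + \<epsilon>)"
  shows "\<exists>C::real. infinite {n::nat. n > 0 \<and>
           real (card (free_graphs n H)) \<le> 2 powr (C * real (ex_number n H))}"
proof (cases "card (edges H) \<le> 1")
  case True
  \<comment> \<open>With \<open>C = 0\<close> the right-hand side is 1 for every value of
    \<open>ex_number\<close>, which may be unspecified for edgeless \<open>H\<close>.\<close>
  have sub: "{max 1 (card (verts H))..} \<subseteq> {n. n > 0 \<and> real (card (free_graphs n H)) \<le> 2 powr (0 * real (ex_number n H))}"
    using free_graphs_few_edges[OF assms(1) True] by auto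
  show ?thesis by (rule exI[of _ 0]) (rule infinite_super[OF sub infinite_Ici])
next
  case False
  note H = assms(1) and eps = assms(2)
  have e: "card (edges H) \<ge> 2" using False by simp
  then have "edges H \<noteq> {}" by auto
  note ex_le = ex_number_le[OF this]
  define a where "a = 1 / two_density H"
  define f where "f n = real (ex_number n H)" for n
  have f_ge: "f n \<ge> \<epsilon> * real n powr (2 - a + \<epsilon>)" if "n \<ge> 2" for n
    using assms(3) that by (simp add: f_def a_def)
  have f_le: "f n \<le> (real n)\<^sup>2" for n unfolding f_def using ex_le[of n] by (metis of_nat_le_iff of_nat_power)
  \<comment> \<open>Otherwise the assumed lower bound would outgrow \<open>n\<^sup>2\<close>. This
    makes \<open>b = a - \<epsilon> / 2\<close> positive.\<close>
  have "\<epsilon> \<le> a"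
  proof (rule ccontr)
    assume "\<not> \<epsilon> \<le> a"
    then have "eventually (\<lambda>n. \<epsilon> * real n powr (\<epsilon> - a) > 1 \<and> n \<ge> 2) sequentially"
      by (intro eventually_conj eventually_powr_gt eps eventually_ge_at_top) simp
    then obtain n where n: "\<epsilon> * real n powr (\<epsilon> - a) > 1" "n \<ge> 2"
      using eventually_happens trivial_limit_sequentially by blast
    have "(real n)\<^sup>2 * 1 < (real n)\<^sup>2 * (\<epsilon> * real n powr (\<epsilon> - a))"
      using n by (intro mult_strict_left_mono) auto
    also have "\<dots> = \<epsilon> * (real n powr 2 * real n powr (\<epsilon> - a))" using n by simp
    also have "real n powr 2 * real n powr (\<epsilon> - a) = real n powr (2 - a + \<epsilon>)"
      by (simp only: powr_add[symmetric]) (simp add: algebra_simps)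
    finally show False using f_ge[OF n(2)] f_le[of n] by simp
  qed
  define b where "b = a - \<epsilon> / 2"
  have b: "b > 0" "1 / two_density H = b + \<epsilon> / 2" using \<open>\<epsilon> \<le> a\<close> eps by (auto simp: b_def a_def)
  define \<eta> where "\<eta> = \<epsilon> / (4 * b)"
  obtain \<delta> C where \<delta>: "0 < \<delta>" "\<delta> < 1" and C: "C \<ge> 0"
    and step: "\<And>n E M K. n \<ge> 1 \<Longrightarrow> E \<subseteq> {e. e \<subseteq> {1..n} \<and> card e = 2} \<Longrightarrow> ex_number n H > 0 \<Longrightarrow>
      \<forall>m\<in>{1..n}. f m * real n powr (2 - b) \<le> f n * real m powr (2 - b) \<Longrightarrow>
      2 powr b * (real n)\<^sup>2 \<le> 16 * f n * real n powr b \<Longrightarrow>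
      K = real (card E) / f n \<Longrightarrow> K \<ge> 16 * 2 powr b \<Longrightarrow>
      \<forall>E'\<subseteq>E. real (card E') \<le> (1 - \<delta>) * real (card E) \<longrightarrow> card (free_edge_sets H n E') \<le> M \<Longrightarrow>
      real (card (free_edge_sets H n E)) \<le> exp (C * f n * K powr (- \<eta>)) * real M"
    using container_step[OF H e eps b] unfolding f_def \<eta>_def by blast
  define K1 where "K1 = max (16 * 2 powr b) (1 / (1 - \<delta>))"
  define L where "L = K1 + C / ((1 - \<delta>) powr (- \<eta>) - 1)"
  let ?R = "{n. n > 0 \<and> (\<forall>m\<in>{1..n}. f m * real n powr (2 - b) \<le> f n * real m powr (2 - b))}"
  \<comment> \<open>The record exponent \<open>2 - b\<close> is
    \<open>2 - a + \<epsilon> / 2\<close>, and the assumed lower bound exceeds it by a further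
    \<open>\<epsilon> / 2\<close>.\<close>
  have "infinite ?R"
    using eps f_ge by (intro infinite_ratio_records[of \<epsilon> "\<epsilon> / 2"]) (auto simp: b_def algebra_simps)
  \<comment> \<open>Beyond \<open>n0\<close> the lower bound on \<open>f\<close> yields the
    comparison with \<open>n\<^sup>2\<close> that \<open>container_step\<close> demands, because
    \<open>(2 - a + \<epsilon>) + b = 2 + \<epsilon> / 2\<close>.\<close>
  obtain n0 where n0: "\<And>n. n \<ge> n0 \<Longrightarrow> 16 * \<epsilon> * real n powr (\<epsilon> / 2) > 2 powr b"
    using eventually_powr_gt[of "16 * \<epsilon>" "\<epsilon> / 2" "2 powr b"] eps
    unfolding eventually_sequentially by auto
  have bound: "real (card (free_graphs n H)) \<le> 2 powr (L / ln 2 * real (ex_number n H))"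
    if n: "n \<in> ?R" "n \<ge> n0" "n \<ge> 2" for n
  proof -
    let ?P = "{e. e \<subseteq> {1..n} \<and> card e = 2}"
    have npos: "real n > 0" using n by simp
    have "0 < \<epsilon> * real n powr (2 - a + \<epsilon>)" using eps npos by simp
    also note f_ge[OF n(3)]
    finally have fpos: "f n > 0" .
    have "2 powr b * (real n)\<^sup>2 \<le> 16 * \<epsilon> * real n powr (\<epsilon> / 2) * (real n)\<^sup>2"
      using n0[OF n(2)] by (intro mult_right_mono) auto
    also have "\<dots> = 16 * (\<epsilon> * (real n powr (\<epsilon> / 2) * real n powr 2))" using npos by simp
    also have "real n powr (\<epsilon> / 2) * real n powr 2 = real n powr (2 - a + \<epsilon>) * real n powr b"
      by (simp only: powr_add[symmetric]) (simp add: b_def algebra_simps)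
    also have "16 * (\<epsilon> * (real n powr (2 - a + \<epsilon>) * real n powr b))
        = 16 * (\<epsilon> * real n powr (2 - a + \<epsilon>)) * real n powr b" by simp
    also have "\<dots> \<le> 16 * f n * real n powr b" using f_ge[OF n(3)] by (intro mult_right_mono) auto
    finally have large: "2 powr b * (real n)\<^sup>2 \<le> 16 * f n * real n powr b" .
    have "real (card (free_graphs n H)) \<le> real (card (free_edge_sets H n ?P))"
      using card_free_graphs_le by simp
    also have "\<dots> \<le> exp (f n * L)"
      unfolding L_def
    proof (rule iterated_container_bound[where cnt = "\<lambda>E. card (free_edge_sets H n E)",
          OF fpos \<delta> _ C])
      show "\<eta> > 0" using eps b by (simp add: \<eta>_def)
      show "1 / (1 - \<delta>) \<le> K1" by (simp add: K1_def)
      show "finite ?P" by (rule finite_pairs) simp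
      show "card (free_edge_sets H n E) \<le> 2 ^ card E" if "E \<subseteq> ?P" for E
      proof -
        have "finite E" by (rule finite_subset[OF that finite_pairs]) simp
        then have "card (free_edge_sets H n E) \<le> card (Pow E)"
          by (intro card_mono) (auto simp: free_edge_sets_def)
        then show ?thesis using \<open>finite E\<close> by (simp add: card_Pow)
      qed
      fix E M assume E: "E \<subseteq> ?P" "real (card E) / f n \<ge> K1"
        and M: "\<And>E'. E' \<subseteq> E \<Longrightarrow> real (card E') \<le> (1 - \<delta>) * real (card E) \<Longrightarrow>
          card (free_edge_sets H n E') \<le> M"
      show "real (card (free_edge_sets H n E))
          \<le> exp (C * f n * (real (card E) / f n) powr (- \<eta>)) * real M"
      proof (rule step[OF _ E(1) _ _ large refl])
        show "n \<ge> 1" using n(3) by simp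
        show "ex_number n H > 0" using fpos by (simp add: f_def)
        show "\<forall>m\<in>{1..n}. f m * real n powr (2 - b) \<le> f n * real m powr (2 - b)" using n(1) by simp
        show "16 * 2 powr b \<le> real (card E) / f n" using E(2) by (simp add: K1_def)
        show "\<forall>E'\<subseteq>E. real (card E') \<le> (1 - \<delta>) * real (card E) \<longrightarrow> card (free_edge_sets H n E') \<le> M"
          by (intro allI impI M)
      qed
    qed
    also have "\<dots> = 2 powr (L / ln 2 * f n)" by (simp add: powr_def)
    finally show ?thesis by (simp add: f_def)
  qed
  have inf: "infinite (?R - {..<max n0 2})" by (rule Diff_infinite_finite) (simp, fact)
  have sub: "?R - {..<max n0 2}
      \<subseteq> {n. n > 0 \<and> real (card (free_graphs n H)) \<le> 2 powr (L / ln 2 * real (ex_number n H))}"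
  proof
    fix n assume "n \<in> ?R - {..<max n0 2}"
    then have n: "n \<in> ?R" "n \<ge> n0" "n \<ge> 2" by auto
    then show "n \<in> {n. n > 0 \<and> real (card (free_graphs n H)) \<le> 2 powr (L / ln 2 * real (ex_number n H))}"
      using bound[OF n] by simp
  qed
  show ?thesis by (rule exI[of _ "L / ln 2"]) (rule infinite_super[OF sub inf])
qed

end
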